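(* Let $(G_n)$ be a weakly convergent sequence of finite connected graphs with uniform vertex degree bound $D\in\mathbb N$, $D\ge1$. Then there exists a holomorphic function $Z:B_{(D-1)^{-1}}\to\mathbb C$ on $B_{(D-1)^{-1}}=\{u\in\mathbb C:|u|<(D-1)^{-1}\}$ such that $Z_{G_n,{\rm norm}}\to Z$ uniformly on compact subsets of $B_{(D-1)^{-1}}$, and the equality $Z=Z_{\mathcal X}$ holds for every limit graphing $\mathcal X$ of $(G_n)$.
   Context: Graphs are undirected without loops or multiple edges: $E\subseteq V\times V$ symmetric, no $(x,x)\in E$. For a graph $G$, $B_r^G(x)$ is the induced graph on the ball of radius $r$ about $x$, rooted at $x$. The radius $\rho$ of a finite connected rooted graph is the maximal distance of a vertex from the root. $\mathcal A^D$ is the set of isomorphism classes of finite connected rooted graphs with vertex degrees at most $D$; $B_r^G(x)\in\alpha$ means that $B^G_r(x)$ represents the class $\alpha$. Weak convergence: for a finite graph $G=(V,E)$ and $\alpha\in\mathcal A^D$ let $p(G,\alpha)=|\{x\in V:B^G_{\rho(\alpha)}(x)\in\alpha\}|/|V|$. A sequence of finite graphs with degrees bounded by $D$ is weakly convergent if $\lim_np(G_n,\alpha)$ exists for every $\alpha\in\mathcal A^D$. Closed paths: a closed path of length $j$ starting at $x$ is a sequence of edges $(e_1,\dots,e_j)$, the terminal vertex of $e_i$ being the origin of $e_{i+1}$, the origin of $e_1$ and the terminal vertex of $e_j$ being $x$. It is reduced if $e_{i+1}\ne\bar e_i$ for $1\le i\le j-1$ and $\bar e_1\ne e_j$ ($\bar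 e$ = reversed edge). $N_j^G(x)$ is the number of reduced closed paths of length $j$ in $G$ starting at $x$. Normalized Zeta function of a finite graph $G=(V,E)$: $Z_{G,{\rm norm}}(u)=\exp\bigl(\sum_{j\ge1}\frac{1}{j}\bigl(\frac1{|V|}\sum_{x\in V}N_j^G(x)\bigr)u^j\bigr)$. Graphing: $\mathcal X=(X,\mu,\iota_1,\dots,\iota_N)$ with $X$ a compact metric space, $\iota_1,\dots,\iota_N:X\to X$ continuous involutions, and $\mu$ a Borel probability measure on $X$ invariant under all $\iota_k$. Let $\mathcal J$ be the group generated by the $\iota_k$. For $x\in X$, $G_x$ is the graph with vertex set the orbit $\mathcal Jx$, in which $y,z$ are adjacent iff $y\ne z$ and $y=\iota_kz$ for some $k$. The Zeta function of $\mathcal X$ (the Ihara Zeta function of the associated measure graph, which takes this form) is $Z_{\mathcal X}(u)=\exp\bigl(\sum_{j\ge1}\frac{1}{j}\bigl(\int_XN_j^{G_x}(x)\,d\mu(x)\bigr)u^j\bigr)$. $\mathcal X$ is a limit graphing of $(G_n)$ if $\lim_np(G_n,\alpha)=\mu(\{x\in X:B^{G_x}_{\rho(\alpha)}(x)\in\alpha\})$ for every $\alpha\in\mathcal A^D$. Convention: $(D-1)^{-1}=\infty$ if $D=1$.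
   Formalization: If G_n is a single vertex for all large n, Z=Z_X is claimed only for limit graphings whose graphs G_x have degrees at most D for almost every x (else K_6 with five matchings, D<5, is a counterexample); Z is chosen per ambient metric space, but is unique as the limit. *)

theory Defs
  imports "HOL-Complex_Analysis.Complex_Analysis" "HOL-Probability.Probability_Measure"
    "HOL-Algebra.Bij" "HOL-Algebra.Generated_Groups"
begin

section \<open>Graphs, balls and weak convergence\<close>

record 'a graph =
  verts :: "'a set"
  edges :: "('a \<times> 'a) set"

definition is_graph :: "'a graph \<Rightarrow> bool" where
  "is_graph G \<longleftrightarrow> edges G \<subseteq> verts G \<times> verts G \<and> sym (edges G) \<and> irrefl (edges G)"

definition graph_connected :: "'a graph \<Rightarrow> bool" where
  "graph_connected G \<longleftrightarrow> verts G \<noteq> {} \<and> (\<forall>x\<in>verts G. \<forall>y\<in>verts G. (x, y) \<in> (edges G)\<^sup>*)"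

definition degree_bounded :: "nat \<Rightarrow> 'a graph \<Rightarrow> bool" where
  "degree_bounded D G \<longleftrightarrow> (\<forall>x\<in>verts G. finite (edges G `` {x}) \<and> card (edges G `` {x}) \<le> D)"

text \<open>The distance is only meaningful for vertices joined by a path; \<open>ball_verts\<close> therefore
  asks for a path explicitly instead of comparing distances.\<close>

definition graph_dist :: "'a graph \<Rightarrow> 'a \<Rightarrow> 'a \<Rightarrow> nat" where
  "graph_dist G x y = (LEAST n. (x, y) \<in> edges G ^^ n)"

definition ball_verts :: "'a graph \<Rightarrow> nat \<Rightarrow> 'a \<Rightarrow> 'a set" where
  "ball_verts G r x = {y \<in> verts G. \<exists>n\<le>r. (x, y) \<in> edges G ^^ n}"

text \<open>A rooted graph is a pair of a graph and its root.\<close>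

definition rooted_ball :: "'a graph \<Rightarrow> nat \<Rightarrow> 'a \<Rightarrow> 'a graph \<times> 'a" where
  "rooted_ball G r x =
     (\<lparr>verts = ball_verts G r x, edges = edges G \<inter> (ball_verts G r x \<times> ball_verts G r x)\<rparr>, x)"

definition graph_radius :: "'a graph \<times> 'a \<Rightarrow> nat" where
  "graph_radius \<alpha> = Max (graph_dist (fst \<alpha>) (snd \<alpha>) ` verts (fst \<alpha>))"

definition rooted_iso :: "'a graph \<times> 'a \<Rightarrow> 'b graph \<times> 'b \<Rightarrow> bool" where
  "rooted_iso \<alpha> \<beta> \<longleftrightarrow>
     (\<exists>f. bij_betw f (verts (fst \<alpha>)) (verts (fst \<beta>)) \<and> f (snd \<alpha>) = snd \<beta> \<and>
          (\<forall>u\<in>verts (fst \<alpha>). \<forall>v\<in>verts (fst \<alpha>).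
             (u, v) \<in> edges (fst \<alpha>) \<longleftrightarrow> (f u, f v) \<in> edges (fst \<beta>)))"

text \<open>An isomorphism class of finite connected rooted graphs is given by a representative whose
  vertices are natural numbers; a rooted graph belongs to the class iff it is isomorphic to
  the representative.  Every class has such representatives, and quantifying over all of them is
  the same as quantifying over classes, since everything below is invariant under isomorphism.\<close>

definition rooted_graphs :: "nat \<Rightarrow> (nat graph \<times> nat) set" where
  "rooted_graphs D =
     {(H, o'). is_graph H \<and> finite (verts H) \<and> graph_connected H \<and> degree_bounded D H \<and> o' \<in> verts H}"

definition ball_freq :: "'a graph \<Rightarrow> nat graph \<times> nat \<Rightarrow> real" where
  "ball_freq G \<alpha> =
     real (card {x \<in> verts G. rooted_iso (rooted_ball G (graph_radius \<alpha>) x) \<alpha>}) / real (card (verts G))"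

definition weakly_convergent :: "nat \<Rightarrow> (nat \<Rightarrow> 'a graph) \<Rightarrow> bool" where
  "weakly_convergent D G \<longleftrightarrow> (\<forall>\<alpha>\<in>rooted_graphs D. convergent (\<lambda>n. ball_freq (G n) \<alpha>))"


section \<open>Reduced closed paths and Zeta functions\<close>

definition reduced_closed_path :: "'a graph \<Rightarrow> nat \<Rightarrow> 'a \<Rightarrow> ('a \<times> 'a) list \<Rightarrow> bool" where
  "reduced_closed_path G j x es \<longleftrightarrow>
     es \<noteq> [] \<and> length es = j \<and> set es \<subseteq> edges G \<and>
     (\<forall>i. Suc i < j \<longrightarrow> snd (es ! i) = fst (es ! Suc i)) \<and>
     fst (hd es) = x \<and> snd (last es) = x \<and>
     (\<forall>i. Suc i < j \<longrightarrow> es ! Suc i \<noteq> prod.swap (es ! i)) \<and>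
     prod.swap (hd es) \<noteq> last es"

definition num_reduced :: "'a graph \<Rightarrow> nat \<Rightarrow> 'a \<Rightarrow> nat" where
  "num_reduced G j x = card {es. reduced_closed_path G j x es}"

text \<open>The sums over \<open>j \<ge> 1\<close> are indexed by \<open>i = j - 1\<close>.\<close>

definition zeta_norm :: "'a graph \<Rightarrow> complex \<Rightarrow> complex" where
  "zeta_norm G u =
     exp (\<Sum>i. 1 / of_nat (Suc i) *
       of_real (1 / real (card (verts G)) * (\<Sum>x\<in>verts G. real (num_reduced G (Suc i) x))) *
       u ^ Suc i)"

definition zeta_disc :: "nat \<Rightarrow> complex set" where
  "zeta_disc D = (if D = 1 then UNIV else ball 0 (inverse (real D - 1)))"


section \<open>Graphings\<close>

text \<open>The involutions are \<open>gr_invol \<X> k\<close> for \<open>k < gr_num \<X>\<close>.\<close>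

record 'b graphing =
  gr_space :: "'b set"
  gr_measure :: "'b measure"
  gr_num :: nat
  gr_invol :: "nat \<Rightarrow> 'b \<Rightarrow> 'b"

definition is_graphing :: "('b :: metric_space) graphing \<Rightarrow> bool" where
  "is_graphing \<X> \<longleftrightarrow>
     compact (gr_space \<X>) \<and>
     sets (gr_measure \<X>) = sets (restrict_space borel (gr_space \<X>)) \<and>
     prob_space (gr_measure \<X>) \<and>
     (\<forall>k<gr_num \<X>.
        continuous_on (gr_space \<X>) (gr_invol \<X> k) \<and>
        gr_invol \<X> k \<in> gr_space \<X> \<rightarrow> gr_space \<X> \<and>
        (\<forall>x\<in>gr_space \<X>. gr_invol \<X> k (gr_invol \<X> k x) = x) \<and>
        distr (gr_measure \<X>) (gr_measure \<X>) (gr_invol \<X> k) = gr_measure \<X>)"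

text \<open>The elements of \<^const>\<open>BijGroup\<close> are extensional functions, hence the restriction.\<close>

definition gr_group :: "'b graphing \<Rightarrow> ('b \<Rightarrow> 'b) set" where
  "gr_group \<X> =
     generate (BijGroup (gr_space \<X>)) ((\<lambda>k. restrict (gr_invol \<X> k) (gr_space \<X>)) ` {..<gr_num \<X>})"

definition gr_orbit :: "'b graphing \<Rightarrow> 'b \<Rightarrow> 'b set" where
  "gr_orbit \<X> x = (\<lambda>g. g x) ` gr_group \<X>"

definition orbit_graph :: "'b graphing \<Rightarrow> 'b \<Rightarrow> 'b graph" where
  "orbit_graph \<X> x =
     \<lparr>verts = gr_orbit \<X> x,
      edges = {(y, z). y \<in> gr_orbit \<X> x \<and> z \<in> gr_orbit \<X> x \<and> y \<noteq> z \<and>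
                       (\<exists>k<gr_num \<X>. y = gr_invol \<X> k z)}\<rparr>"

definition zeta_graphing :: "'b graphing \<Rightarrow> complex \<Rightarrow> complex" where
  "zeta_graphing \<X> u =
     exp (\<Sum>i. 1 / of_nat (Suc i) *
       of_real (\<integral>x. real (num_reduced (orbit_graph \<X> x) (Suc i) x) \<partial>gr_measure \<X>) *
       u ^ Suc i)"

text \<open>Only classes of degree at most \<open>D\<close> are tested, each at its own radius.  If all \<open>G n\<close> are
  single vertices, the only class of positive frequency has radius 0 and is represented by every
  ball of radius 0.  So any graphing in which almost every vertex has degree greater than \<open>D\<close>
  satisfies this condition (e.g. the one given by the complete graph on 6 vertices, uniform
  measure and five perfect matchings, for \<open>D < 5\<close>), although its Zeta function is not that of a
  single vertex.  If instead infinitely many \<open>G n\<close> are connected with at least two vertices and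
  degrees at most \<open>D\<close>, then the classes of radius 1 have limit frequencies adding up to 1, and
  almost every orbit graph of a limit graphing has degrees at most \<open>D\<close>.\<close>

definition limit_graphing :: "nat \<Rightarrow> (nat \<Rightarrow> 'a graph) \<Rightarrow> ('b :: metric_space) graphing \<Rightarrow> bool" where
  "limit_graphing D G \<X> \<longleftrightarrow>
     is_graphing \<X> \<and>
     (\<forall>\<alpha>\<in>rooted_graphs D.
        (\<lambda>n. ball_freq (G n) \<alpha>) \<longlonglongrightarrow>
          measure (gr_measure \<X>)
            {x \<in> gr_space \<X>. rooted_iso (rooted_ball (orbit_graph \<X> x) (graph_radius \<alpha>) x) \<alpha>})"

end

theory Submission
  imports Defs
begin

text \<open>The coefficient of \<open>u ^ j\<close> in the logarithm of the normalized Zeta function is, up to the factor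
  \<open>1 / j\<close>, the mean of \<open>N_j(x)\<close>, the number of reduced closed paths of length \<open>j\<close> at \<open>x\<close>. This
  number depends only on the ball \<open>B_j(x)\<close>, and it telescopes over the radius:
  \<open>N_j(x) = (\<Sum>s<j. N_j(B_(s+1)(x)) - N_j(B_s(x)))\<close>, because the one-point ball has no paths. A summand
  can be nonzero only if the ball still grows from \<open>s\<close> to \<open>s + 1\<close>. Then \<open>B_(s+1)(x)\<close> has radius
  exactly \<open>s + 1\<close>, its class \<open>\<alpha>\<close> is one of those tested by weak convergence at this radius, and
  the summand is a constant that depends on \<open>\<alpha>\<close> and \<open>j\<close> only. There are finitely many classes of
  radius \<open>s + 1\<close> and degree at most \<open>D\<close>, so \<open>N_j\<close> is one fixed finite linear combination of the
  events "the ball about \<open>x\<close> of the radius of \<open>\<alpha>\<close> lies in \<open>\<alpha>\<close>", the same for all graphs of degree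
  at most \<open>D\<close> (\<open>num_reduced_eq_sum_classes\<close>). Single frequencies do not tell
  whether a ball has stopped growing, since that of \<open>\<alpha>\<close> also counts the vertices whose component
  continues beyond \<open>\<alpha>\<close>; an increment vanishes where the ball has stopped growing.

  Averaging over a finite graph turns the events into the frequencies \<open>p(G, \<alpha>)\<close>, so the coefficients
  converge along \<open>(G_n)\<close>. Integrating over a limit graphing turns them into the measures that are the
  limits of these frequencies, so the coefficients of its Zeta function are the limits. The
  integration requires that almost every orbit graph has degrees at most \<open>D\<close>, which follows
  from the frequencies of the classes of radius \<open>1\<close> unless the \<open>G_n\<close> are eventually single
  vertices (\<open>AE_degree_bounded\<close>). It also requires measurability: whether a local property holds at
  \<open>x\<close> is decided by the finitely many coincidences \<open>w x = w' x\<close> between short words in the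
  involutions, and each of them defines a closed set.

  Finally, \<open>N_j(x) \<le> D * (D - 1) ^ (j - 1)\<close>, since a path without backtracking has at most \<open>D - 1\<close>
  continuations at each step. By this geometric majorant, convergence of the coefficients implies
  uniform convergence of the series, and of their exponentials, on compact subsets of the disc
  (\<open>uniform_limit_exp_zeta_series\<close>).\<close>

section \<open>Isomorphisms, balls and radii\<close>

text \<open>Since \<^const>\<open>rooted_iso\<close> compares edges between vertices only, both sides are required to be
  graphs, so that an isomorphism maps all edges to edges.\<close>

definition graph_iso :: "('a \<Rightarrow> 'b) \<Rightarrow> 'a graph \<Rightarrow> 'b graph \<Rightarrow> bool" where
  "graph_iso f A B \<longleftrightarrow> is_graph A \<and> is_graph B \<and> bij_betw f (verts A) (verts B) \<and>
     (\<forall>u\<in>verts A. \<forall>v\<in>verts A. (u, v) \<in> edges A \<longleftrightarrow> (f u, f v) \<in> edges B)"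

lemma rooted_iso_iff:
  assumes "is_graph (fst \<alpha>)" "is_graph (fst \<beta>)"
  shows "rooted_iso \<alpha> \<beta> \<longleftrightarrow> (\<exists>f. graph_iso f (fst \<alpha>) (fst \<beta>) \<and> f (snd \<alpha>) = snd \<beta>)"
  using assms by (auto simp: rooted_iso_def graph_iso_def)

lemma graph_iso_mem: "graph_iso f A B \<Longrightarrow> x \<in> verts A \<Longrightarrow> f x \<in> verts B"
  by (auto simp: graph_iso_def bij_betw_def)

lemma graph_iso_edge: "graph_iso f A B \<Longrightarrow> (x, y) \<in> edges A \<Longrightarrow> (f x, f y) \<in> edges B"
  unfolding graph_iso_def is_graph_def by blast

lemma graph_iso_inv_into:
  assumes "graph_iso f A B" "x \<in> verts A"
  shows "inv_into (verts A) f (f x) = x"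
  using assms by (auto simp: graph_iso_def bij_betw_def)

lemma graph_iso_inverse:
  assumes "graph_iso f A B"
  shows "graph_iso (inv_into (verts A) f) B A"
proof -
  have f: "bij_betw f (verts A) (verts B)" using assms by (simp add: graph_iso_def)
  have g: "bij_betw (inv_into (verts A) f) (verts B) (verts A)"
    using f by (rule bij_betw_inv_into)
  have "inv_into (verts A) f u \<in> verts A" "f (inv_into (verts A) f u) = u" if "u \<in> verts B" for u
    using f g that by (auto simp: bij_betw_def f_inv_into_f inv_into_into)
  then show ?thesis using assms g unfolding graph_iso_def by metis
qed

lemma graph_iso_comp:
  assumes f: "graph_iso f A B" and g: "graph_iso g B C"
  shows "graph_iso (g \<circ> f) A C"
proof -
  have "bij_betw (g \<circ> f) (verts A) (verts C)"
    using f g unfolding graph_iso_def by (meson bij_betw_trans)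
  then show ?thesis
    using f g graph_iso_mem[OF f] unfolding graph_iso_def by simp
qed

lemma rooted_iso_refl: "rooted_iso \<alpha> \<alpha>"
  unfolding rooted_iso_def by (rule exI[of _ id]) auto

lemma rooted_iso_sym:
  assumes "is_graph (fst \<alpha>)" "is_graph (fst \<beta>)" "snd \<alpha> \<in> verts (fst \<alpha>)" "rooted_iso \<alpha> \<beta>"
  shows "rooted_iso \<beta> \<alpha>"
proof -
  obtain f where f: "graph_iso f (fst \<alpha>) (fst \<beta>)" "f (snd \<alpha>) = snd \<beta>"
    using assms rooted_iso_iff by blast
  have "inv_into (verts (fst \<alpha>)) f (snd \<beta>) = snd \<alpha>"
    using graph_iso_inv_into[OF f(1) assms(3)] f(2) by simp
  then show ?thesis
    using graph_iso_inverse[OF f(1)] assms rooted_iso_iff by blast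
qed

lemma rooted_iso_trans:
  assumes "is_graph (fst \<alpha>)" "is_graph (fst \<beta>)" "is_graph (fst \<gamma>)"
    "rooted_iso \<alpha> \<beta>" "rooted_iso \<beta> \<gamma>"
  shows "rooted_iso \<alpha> \<gamma>"
proof -
  obtain f where f: "graph_iso f (fst \<alpha>) (fst \<beta>)" "f (snd \<alpha>) = snd \<beta>"
    using assms rooted_iso_iff by blast
  obtain g where g: "graph_iso g (fst \<beta>) (fst \<gamma>)" "g (snd \<beta>) = snd \<gamma>"
    using assms rooted_iso_iff by blast
  have "(g \<circ> f) (snd \<alpha>) = snd \<gamma>" using f g by simp
  then show ?thesis using graph_iso_comp[OF f(1) g(1)] assms rooted_iso_iff by blast
qed

lemma relpow_verts:
  assumes "is_graph G" "x \<in> verts G" "(x, y) \<in> edges G ^^ n"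
  shows "y \<in> verts G"
  using assms by (cases n) (auto simp: is_graph_def)

lemma graph_iso_relpow_mono:
  assumes f: "graph_iso f A B" and "x \<in> verts A" "(x, y) \<in> edges A ^^ n"
  shows "(f x, f y) \<in> edges B ^^ n"
  using assms(3)
proof (induction n arbitrary: y)
  case (Suc n)
  then obtain z where "(x, z) \<in> edges A ^^ n" "(z, y) \<in> edges A" by auto
  then show ?case using Suc.IH graph_iso_edge[OF f] by auto
qed auto

lemma graph_iso_relpow:
  assumes f: "graph_iso f A B" and x: "x \<in> verts A" and y: "y \<in> verts A"
  shows "(f x, f y) \<in> edges B ^^ n \<longleftrightarrow> (x, y) \<in> edges A ^^ n"
proof
  assume "(f x, f y) \<in> edges B ^^ n"
  from graph_iso_relpow_mono[OF graph_iso_inverse[OF f] graph_iso_mem[OF f x] this]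
  show "(x, y) \<in> edges A ^^ n"
    using graph_iso_inv_into[OF f x] graph_iso_inv_into[OF f y] by simp
qed (rule graph_iso_relpow_mono[OF f x])

lemma graph_radius_iso:
  assumes "is_graph (fst \<alpha>)" "is_graph (fst \<beta>)" "snd \<alpha> \<in> verts (fst \<alpha>)" "rooted_iso \<alpha> \<beta>"
  shows "graph_radius \<alpha> = graph_radius \<beta>"
proof -
  obtain f where f: "graph_iso f (fst \<alpha>) (fst \<beta>)" "f (snd \<alpha>) = snd \<beta>"
    using assms rooted_iso_iff by blast
  have "verts (fst \<beta>) = f ` verts (fst \<alpha>)"
    using f(1) by (simp add: graph_iso_def bij_betw_def)
  moreover have "graph_dist (fst \<beta>) (snd \<beta>) (f v) = graph_dist (fst \<alpha>) (snd \<alpha>) v"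
    if "v \<in> verts (fst \<alpha>)" for v
    using graph_iso_relpow[OF f(1) assms(3) that] by (simp add: graph_dist_def f(2))
  ultimately show ?thesis by (simp add: graph_radius_def image_image cong: image_cong)
qed

lemma rooted_ball_simps [simp]:
  "verts (fst (rooted_ball G r x)) = ball_verts G r x"
  "edges (fst (rooted_ball G r x)) = edges G \<inter> (ball_verts G r x \<times> ball_verts G r x)"
  "snd (rooted_ball G r x) = x"
  by (simp_all add: rooted_ball_def)

lemma ball_verts_iso:
  assumes f: "graph_iso f A B" and x: "x \<in> verts A"
  shows "ball_verts B r (f x) = f ` ball_verts A r x"
proof -
  have "verts B = f ` verts A" using f by (simp add: graph_iso_def bij_betw_def)
  moreover have "ball_verts A r x = {y \<in> verts A. \<exists>n\<le>r. (f x, f y) \<in> edges B ^^ n}"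
    by (simp add: ball_verts_def graph_iso_relpow[OF f x] cong: conj_cong)
  ultimately show ?thesis unfolding ball_verts_def[of B] by auto
qed

lemma is_graph_rooted_ball: "is_graph G \<Longrightarrow> is_graph (fst (rooted_ball G r x))"
  by (auto simp: is_graph_def sym_def irrefl_def)

lemma ball_verts_subset: "ball_verts G r x \<subseteq> verts G"
  by (auto simp: ball_verts_def)

lemma root_in_ball: "x \<in> verts G \<Longrightarrow> x \<in> ball_verts G r x"
  unfolding ball_verts_def by (auto intro: exI[of _ 0])

lemma ball_verts_mono: "r \<le> s \<Longrightarrow> ball_verts G r x \<subseteq> ball_verts G s x"
  unfolding ball_verts_def using le_trans by blast

lemma rooted_ball_iso:
  assumes "is_graph (fst \<alpha>)" "is_graph (fst \<beta>)" "snd \<alpha> \<in> verts (fst \<alpha>)" "rooted_iso \<alpha> \<beta>"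
  shows "rooted_iso (rooted_ball (fst \<alpha>) r (snd \<alpha>)) (rooted_ball (fst \<beta>) r (snd \<beta>))"
proof -
  obtain f where f: "graph_iso f (fst \<alpha>) (fst \<beta>)" "f (snd \<alpha>) = snd \<beta>"
    using assms rooted_iso_iff by blast
  let ?U = "ball_verts (fst \<alpha>) r (snd \<alpha>)"
  have V: "ball_verts (fst \<beta>) r (snd \<beta>) = f ` ?U"
    using ball_verts_iso[OF f(1) assms(3)] f(2) by simp
  have inj: "inj_on f (verts (fst \<alpha>))" using f(1) by (simp add: graph_iso_def bij_betw_def)
  have sub: "?U \<subseteq> verts (fst \<alpha>)" by (rule ball_verts_subset)
  have "bij_betw f ?U (f ` ?U)" using inj_on_subset[OF inj sub] by (simp add: bij_betw_def)
  moreover have "(u, v) \<in> edges (fst \<alpha>) \<longleftrightarrow> (f u, f v) \<in> edges (fst \<beta>)" if "u \<in> ?U" "v \<in> ?U" for u v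
    using f(1) that sub unfolding graph_iso_def by blast
  ultimately show ?thesis
    unfolding rooted_iso_def using f(2) by (intro exI[of _ f]) (simp add: V)
qed

text \<open>A shortest path from the centre of a ball does not leave the ball, so distances from the
  centre, and smaller balls about it, can be computed inside the ball.\<close>

lemma relpow_in_ball:
  assumes "is_graph G" "x \<in> verts G" "(x, y) \<in> edges G ^^ n" "n \<le> r"
  shows "(x, y) \<in> edges (fst (rooted_ball G r x)) ^^ n"
  using assms(3,4)
proof (induction n arbitrary: y)
  case (Suc n)
  then obtain z where z: "(x, z) \<in> edges G ^^ n" "(z, y) \<in> edges G" by auto
  have "y \<in> ball_verts G r x"
    unfolding ball_verts_def using Suc.prems relpow_verts[OF assms(1,2) Suc.prems(1)] by blast
  moreover have "z \<in> ball_verts G r x"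
    unfolding ball_verts_def using z(1) relpow_verts[OF assms(1,2) z(1)] Suc_leD[OF Suc.prems(2)]
    by blast
  moreover have "(x, z) \<in> edges (fst (rooted_ball G r x)) ^^ n"
    using Suc.IH[OF z(1)] Suc.prems(2) by simp
  ultimately show ?case using z(2) by auto
qed auto

lemma ball_verts_rooted_ball:
  assumes "is_graph G" "x \<in> verts G" "s \<le> r"
  shows "ball_verts (fst (rooted_ball G r x)) s x = ball_verts G s x"
proof
  have "edges (fst (rooted_ball G r x)) ^^ n \<subseteq> edges G ^^ n" for n
    by (induction n) auto
  then show "ball_verts (fst (rooted_ball G r x)) s x \<subseteq> ball_verts G s x"
    using ball_verts_subset[of G r x] unfolding ball_verts_def[of _ s] by auto
  show "ball_verts G s x \<subseteq> ball_verts (fst (rooted_ball G r x)) s x"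
  proof
    fix y assume y: "y \<in> ball_verts G s x"
    then obtain n where n: "n \<le> s" "(x, y) \<in> edges G ^^ n" by (auto simp: ball_verts_def)
    have "y \<in> ball_verts G r x" using y ball_verts_mono[OF assms(3), of G x] by blast
    moreover have "(x, y) \<in> edges (fst (rooted_ball G r x)) ^^ n"
      using relpow_in_ball[OF assms(1,2) n(2)] n(1) assms(3) by simp
    ultimately show "y \<in> ball_verts (fst (rooted_ball G r x)) s x"
      using n(1) unfolding ball_verts_def[of "fst (rooted_ball G r x)"] by auto
  qed
qed

lemma rooted_ball_rooted_ball:
  assumes "is_graph G" "x \<in> verts G" "s \<le> r"
  shows "rooted_ball (fst (rooted_ball G r x)) s x = rooted_ball G s x"
proof -
  note eq = ball_verts_rooted_ball[OF assms]
  have "ball_verts G s x \<subseteq> ball_verts G r x" by (rule ball_verts_mono[OF assms(3)])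
  then show ?thesis unfolding rooted_ball_def[of _ s] eq by auto
qed

lemma graph_radius_le_iff:
  assumes "finite (verts A)" "x \<in> verts A" "\<And>y. y \<in> verts A \<Longrightarrow> \<exists>n. (x, y) \<in> edges A ^^ n"
  shows "graph_radius (A, x) \<le> r \<longleftrightarrow> verts A = ball_verts A r x"
proof -
  have "graph_dist A x y \<le> r \<longleftrightarrow> (\<exists>n\<le>r. (x, y) \<in> edges A ^^ n)" if y: "y \<in> verts A" for y
  proof
    assume "graph_dist A x y \<le> r"
    moreover have "(x, y) \<in> edges A ^^ graph_dist A x y"
      using assms(3)[OF y] unfolding graph_dist_def by (rule LeastI_ex)
    ultimately show "\<exists>n\<le>r. (x, y) \<in> edges A ^^ n" by blast
  next
    assume "\<exists>n\<le>r. (x, y) \<in> edges A ^^ n"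
    then show "graph_dist A x y \<le> r" unfolding graph_dist_def by (meson Least_le le_trans)
  qed
  moreover have "graph_radius (A, x) \<le> r \<longleftrightarrow> (\<forall>y\<in>verts A. graph_dist A x y \<le> r)"
    unfolding graph_radius_def using assms(1,2) by (subst Max_le_iff) auto
  ultimately show ?thesis by (auto simp: ball_verts_def)
qed

lemma graph_radius_rooted_ball_le_iff:
  assumes "is_graph G" "x \<in> verts G" "finite (ball_verts G r x)" "s \<le> r"
  shows "graph_radius (rooted_ball G r x) \<le> s \<longleftrightarrow> ball_verts G r x = ball_verts G s x"
proof -
  have "\<exists>n. (x, y) \<in> edges (fst (rooted_ball G r x)) ^^ n" if "y \<in> ball_verts G r x" for y
    using that relpow_in_ball[OF assms(1,2)] unfolding ball_verts_def[of G] by blast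
  then have "graph_radius (fst (rooted_ball G r x), x) \<le> s \<longleftrightarrow>
      ball_verts G r x = ball_verts (fst (rooted_ball G r x)) s x"
    using graph_radius_le_iff[of "fst (rooted_ball G r x)" x s] assms root_in_ball by fastforce
  moreover have "(fst (rooted_ball G r x), x) = rooted_ball G r x" by (simp add: rooted_ball_def)
  ultimately show ?thesis using ball_verts_rooted_ball[OF assms(1,2,4)] by simp
qed

section \<open>Finitely many classes of each radius\<close>

lemma ball_verts_card:
  assumes "is_graph G" "degree_bounded D G" "x \<in> verts G"
  shows "finite (ball_verts G r x) \<and> card (ball_verts G r x) \<le> Suc D ^ r"
proof (induction r)
  case 0
  have "ball_verts G 0 x = {x}" using assms(3) by (auto simp: ball_verts_def)
  then show ?case by simp
next
  case (Suc r)
  let ?B = "ball_verts G r x" and ?N = "\<lambda>y. insert y (edges G `` {y})"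
  have deg: "finite (edges G `` {y})" "card (edges G `` {y}) \<le> D" if "y \<in> ?B" for y
    using that assms(2) ball_verts_subset[of G r x] by (auto simp: degree_bounded_def)
  have sub: "ball_verts G (Suc r) x \<subseteq> (\<Union>y\<in>?B. ?N y)"
  proof
    fix y assume "y \<in> ball_verts G (Suc r) x"
    then obtain n where n: "n \<le> Suc r" "(x, y) \<in> edges G ^^ n" "y \<in> verts G"
      by (auto simp: ball_verts_def)
    show "y \<in> (\<Union>y\<in>?B. ?N y)"
    proof (cases "n = Suc r")
      case True
      then obtain z where z: "(x, z) \<in> edges G ^^ r" "(z, y) \<in> edges G" using n by auto
      then have "z \<in> ?B" using relpow_verts[OF assms(1,3)] by (auto simp: ball_verts_def)
      then show ?thesis using z by auto
    next
      case False
      then have "n \<le> r" using n(1) by simp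
      then have "y \<in> ?B" using n(2,3) by (auto simp: ball_verts_def)
      then show ?thesis by auto
    qed
  qed
  have fin: "finite (\<Union>y\<in>?B. ?N y)" using Suc deg by auto
  have "card (ball_verts G (Suc r) x) \<le> card (\<Union>y\<in>?B. ?N y)" by (rule card_mono[OF fin sub])
  also have "\<dots> \<le> (\<Sum>y\<in>?B. card (?N y))" by (rule card_UN_le) (use Suc in simp)
  also have "\<dots> \<le> (\<Sum>y\<in>?B. Suc D)"
    by (intro sum_mono order.trans[OF card_insert_le_m1]) (use deg in auto)
  also have "\<dots> = card ?B * Suc D" by simp
  also have "\<dots> \<le> Suc D ^ r * Suc D" using Suc by (intro mult_right_mono) auto
  also have "\<dots> = Suc D ^ Suc r" by simp
  finally show ?case using finite_subset[OF sub fin] by simp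
qed

lemma degree_bounded_rooted_ball:
  assumes "degree_bounded D G"
  shows "degree_bounded D (fst (rooted_ball G r x))"
  unfolding degree_bounded_def
proof
  fix y assume "y \<in> verts (fst (rooted_ball G r x))"
  then have "y \<in> verts G" using ball_verts_subset[of G r x] by auto
  then have fin: "finite (edges G `` {y})" and card: "card (edges G `` {y}) \<le> D"
    using assms by (auto simp: degree_bounded_def)
  have sub: "edges (fst (rooted_ball G r x)) `` {y} \<subseteq> edges G `` {y}" by auto
  from card_mono[OF fin sub] finite_subset[OF sub fin] card
  show "finite (edges (fst (rooted_ball G r x)) `` {y}) \<and>
      card (edges (fst (rooted_ball G r x)) `` {y}) \<le> D" by simp
qed

lemma graph_connected_rooted_ball:
  assumes "is_graph G" "x \<in> verts G"
  shows "graph_connected (fst (rooted_ball G r x))"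
proof -
  let ?E = "edges (fst (rooted_ball G r x))"
  have to: "(x, y) \<in> ?E\<^sup>*" if "y \<in> ball_verts G r x" for y
    using that relpow_in_ball[OF assms] relpow_imp_rtrancl unfolding ball_verts_def[of G] by blast
  have "sym ?E" using is_graph_rooted_ball[OF assms(1), of r x] by (simp add: is_graph_def)
  then have "sym (?E\<^sup>*)" by (rule sym_rtrancl)
  then have "(y, z) \<in> ?E\<^sup>*" if "y \<in> ball_verts G r x" "z \<in> ball_verts G r x" for y z
    using to[OF that(1)] to[OF that(2)] by (meson rtrancl_trans symD)
  then show ?thesis
    using root_in_ball[OF assms(2), of r] unfolding graph_connected_def by auto
qed

lemma degree_bounded_iso:
  assumes f: "graph_iso f A B" and "degree_bounded D A"
  shows "degree_bounded D B"
  unfolding degree_bounded_def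
proof
  fix y assume "y \<in> verts B"
  moreover have V: "verts B = f ` verts A" using f by (simp add: graph_iso_def bij_betw_def)
  ultimately obtain x where x: "x \<in> verts A" "y = f x" by blast
  have "edges B `` {f x} = f ` (edges A `` {x})"
  proof
    show "f ` (edges A `` {x}) \<subseteq> edges B `` {f x}" using graph_iso_edge[OF f] by auto
    show "edges B `` {f x} \<subseteq> f ` (edges A `` {x})"
    proof
      fix z assume z: "z \<in> edges B `` {f x}"
      then have "z \<in> verts B" using f by (auto simp: graph_iso_def is_graph_def)
      then obtain w where "w \<in> verts A" "z = f w" using V by blast
      then show "z \<in> f ` (edges A `` {x})" using z f x by (auto simp: graph_iso_def)
    qed
  qed
  moreover have "finite (edges A `` {x})" "card (edges A `` {x}) \<le> D"
    using assms(2) x by (auto simp: degree_bounded_def)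
  ultimately show "finite (edges B `` {y}) \<and> card (edges B `` {y}) \<le> D"
    using x card_image_le[of "edges A `` {x}" f] by auto
qed

lemma graph_connected_iso:
  assumes f: "graph_iso f A B" and "graph_connected A"
  shows "graph_connected B"
proof -
  have V: "verts B = f ` verts A" using f by (simp add: graph_iso_def bij_betw_def)
  have "(f x, f y) \<in> (edges B)\<^sup>*" if "x \<in> verts A" "y \<in> verts A" for x y
  proof -
    have "(x, y) \<in> (edges A)\<^sup>*" using assms(2) that by (simp add: graph_connected_def)
    then obtain n where "(x, y) \<in> edges A ^^ n" using rtrancl_imp_relpow by blast
    then show ?thesis using graph_iso_relpow_mono[OF f that(1)] relpow_imp_rtrancl by blast
  qed
  then show ?thesis using assms(2) by (auto simp: graph_connected_def V)
qed

lemma finite_graph_iso_nat: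
  assumes "is_graph A" "finite (verts A)"
  obtains f and B :: "nat graph" where "graph_iso f A B" "verts B = {..<card (verts A)}"
proof -
  obtain f where f: "bij_betw f (verts A) {0..<card (verts A)}"
    using ex_bij_betw_finite_nat[OF assms(2)] by blast
  have inj: "f u = f v \<Longrightarrow> u = v" if "u \<in> verts A" "v \<in> verts A" for u v
    using f that by (meson bij_betw_def inj_onD)
  define B where "B = \<lparr>verts = {..<card (verts A)}, edges = map_prod f f ` edges A\<rparr>"
  have E: "(u, v) \<in> edges A \<Longrightarrow> u \<in> verts A \<and> v \<in> verts A" for u v
    using assms(1) by (auto simp: is_graph_def)
  have EB: "(a, b) \<in> edges B \<longleftrightarrow> (\<exists>u v. (u, v) \<in> edges A \<and> a = f u \<and> b = f v)" for a b
    by (auto simp: B_def)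
  have iff: "(f u, f v) \<in> edges B \<longleftrightarrow> (u, v) \<in> edges A" if uv: "u \<in> verts A" "v \<in> verts A" for u v
  proof
    assume "(f u, f v) \<in> edges B"
    then obtain u' v' where "(u', v') \<in> edges A" "f u = f u'" "f v = f v'" by (auto simp: EB)
    then show "(u, v) \<in> edges A" using E[of u' v'] inj[of u u'] inj[of v v'] uv by simp
  qed (auto simp: EB)
  have "is_graph B"
    unfolding is_graph_def
  proof (intro conjI)
    have "f u < card (verts A)" if "u \<in> verts A" for u
      using bij_betwE[OF f] that by auto
    then show "edges B \<subseteq> verts B \<times> verts B"
      using E by (auto simp: B_def)
    have "(v, u) \<in> edges A" if "(u, v) \<in> edges A" for u v
      using assms(1) that by (auto simp: is_graph_def sym_def)
    then show "sym (edges B)" unfolding sym_def EB by blast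
    have "f u \<noteq> f v" if "(u, v) \<in> edges A" for u v
      using inj[of u v] E[OF that] that assms(1) by (auto simp: is_graph_def irrefl_def)
    then show "irrefl (edges B)" unfolding irrefl_def EB by metis
  qed
  then have "graph_iso f A B"
    using assms(1) f iff by (simp add: graph_iso_def B_def atLeast0LessThan)
  then show ?thesis by (rule that) (simp add: B_def)
qed

lemma rooted_graphsD:
  assumes "\<alpha> \<in> rooted_graphs D"
  shows "is_graph (fst \<alpha>)" "finite (verts (fst \<alpha>))" "graph_connected (fst \<alpha>)"
    "degree_bounded D (fst \<alpha>)" "snd \<alpha> \<in> verts (fst \<alpha>)"
  using assms by (auto simp: rooted_graphs_def)

lemma rooted_ball_class:
  assumes "is_graph G" "degree_bounded D G" "x \<in> verts G"
  shows "\<exists>\<alpha>\<in>rooted_graphs D. verts (fst \<alpha>) \<subseteq> {..<Suc D ^ r} \<and> rooted_iso (rooted_ball G r x) \<alpha>"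
proof -
  let ?A = "fst (rooted_ball G r x)"
  have A: "is_graph ?A" by (rule is_graph_rooted_ball[OF assms(1)])
  have c: "finite (verts ?A)" "card (verts ?A) \<le> Suc D ^ r"
    using ball_verts_card[OF assms] by auto
  obtain f and B :: "nat graph" where f: "graph_iso f ?A B" "verts B = {..<card (verts ?A)}"
    using finite_graph_iso_nat[OF A c(1)] by blast
  have root: "x \<in> verts ?A" using root_in_ball[OF assms(3)] by simp
  have "(B, f x) \<in> rooted_graphs D"
    using f degree_bounded_iso[OF f(1) degree_bounded_rooted_ball[OF assms(2)]]
      graph_connected_iso[OF f(1) graph_connected_rooted_ball[OF assms(1,3)]]
      graph_iso_mem[OF f(1) root]
    by (simp add: rooted_graphs_def graph_iso_def)
  moreover have "rooted_iso (rooted_ball G r x) (B, f x)"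
    using f(1) A rooted_iso_iff[of "rooted_ball G r x" "(B, f x)"] by (auto simp: graph_iso_def)
  ultimately show ?thesis using f(2) c(2) by (intro bexI[of _ "(B, f x)"]) auto
qed

lemma rooted_ball_graph_radius:
  assumes "\<alpha> \<in> rooted_graphs D"
  shows "rooted_ball (fst \<alpha>) (graph_radius \<alpha>) (snd \<alpha>) = \<alpha>"
proof -
  note \<alpha> = rooted_graphsD[OF assms]
  have "\<exists>n. (snd \<alpha>, y) \<in> edges (fst \<alpha>) ^^ n" if "y \<in> verts (fst \<alpha>)" for y
    using that \<alpha>(3,5) rtrancl_imp_relpow unfolding graph_connected_def by blast
  then have "verts (fst \<alpha>) = ball_verts (fst \<alpha>) (graph_radius \<alpha>) (snd \<alpha>)"
    using graph_radius_le_iff[OF \<alpha>(2,5), of "graph_radius \<alpha>"] by simp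
  moreover have "edges (fst \<alpha>) \<inter> (verts (fst \<alpha>) \<times> verts (fst \<alpha>)) = edges (fst \<alpha>)"
    using \<alpha>(1) by (auto simp: is_graph_def)
  ultimately show ?thesis by (simp add: rooted_ball_def prod_eq_iff)
qed

lemma finite_rooted_graphs_on:
  assumes "finite S"
  shows "finite {\<alpha> \<in> rooted_graphs D. verts (fst \<alpha>) \<subseteq> S}"
proof (rule finite_subset)
  let ?f = "\<lambda>(V, E, v). (\<lparr>verts = V, edges = E\<rparr>, v) :: nat graph \<times> nat"
  show "finite (?f ` (Pow S \<times> Pow (S \<times> S) \<times> S))" using assms by simp
  show "{\<alpha> \<in> rooted_graphs D. verts (fst \<alpha>) \<subseteq> S} \<subseteq> ?f ` (Pow S \<times> Pow (S \<times> S) \<times> S)"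
  proof
    fix \<alpha> :: "nat graph \<times> nat" assume "\<alpha> \<in> {\<alpha> \<in> rooted_graphs D. verts (fst \<alpha>) \<subseteq> S}"
    then have "\<alpha> \<in> rooted_graphs D" "verts (fst \<alpha>) \<subseteq> S" by auto
    moreover have "edges (fst \<alpha>) \<subseteq> S \<times> S" "snd \<alpha> \<in> S"
      using rooted_graphsD[OF calculation(1)] calculation(2) by (auto simp: is_graph_def)
    ultimately show "\<alpha> \<in> ?f ` (Pow S \<times> Pow (S \<times> S) \<times> S)"
      by (intro image_eqI[of _ _ "(verts (fst \<alpha>), edges (fst \<alpha>), snd \<alpha>)"])
        (auto simp: prod_eq_iff)
  qed
qed

text \<open>A ball of radius \<open>s\<close> in a graph of degree at most \<open>D\<close> has at most \<open>(D + 1) ^ s\<close> vertices,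
  which may be renamed to the first natural numbers.\<close>

lemma class_representatives_exist:
  "\<exists>T. finite T \<and> T \<subseteq> {\<alpha> \<in> rooted_graphs D. graph_radius \<alpha> = s} \<and>
     (\<forall>\<alpha>\<in>rooted_graphs D. graph_radius \<alpha> = s \<longrightarrow>
        (\<exists>\<beta>\<in>T. \<forall>\<gamma>\<in>T. rooted_iso \<alpha> \<gamma> \<longleftrightarrow> \<gamma> = \<beta>))"
proof -
  define F where "F = {\<alpha> \<in> rooted_graphs D. graph_radius \<alpha> = s \<and> verts (fst \<alpha>) \<subseteq> {..<Suc D ^ s}}"
  define c where "c = (\<lambda>\<alpha> :: nat graph \<times> nat. SOME \<beta>. \<beta> \<in> F \<and> rooted_iso \<alpha> \<beta>)"
  have sym: "rooted_iso \<beta> \<alpha>" if "\<alpha> \<in> rooted_graphs D" "\<beta> \<in> rooted_graphs D" "rooted_iso \<alpha> \<beta>" for \<alpha> \<beta>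
    using rooted_iso_sym[OF _ _ _ that(3)] rooted_graphsD[OF that(1)] rooted_graphsD[OF that(2)] by simp
  have trans: "rooted_iso \<alpha> \<gamma>" if "\<alpha> \<in> rooted_graphs D" "\<beta> \<in> rooted_graphs D" "\<gamma> \<in> rooted_graphs D"
    "rooted_iso \<alpha> \<beta>" "rooted_iso \<beta> \<gamma>" for \<alpha> \<beta> \<gamma>
    using rooted_iso_trans[OF _ _ _ that(4,5)] rooted_graphsD(1) that(1-3) by simp
  have FD: "\<alpha> \<in> F \<Longrightarrow> \<alpha> \<in> rooted_graphs D" for \<alpha> by (simp add: F_def)
  have exF: "\<exists>\<beta>\<in>F. rooted_iso \<alpha> \<beta>" if \<alpha>: "\<alpha> \<in> rooted_graphs D" "graph_radius \<alpha> = s" for \<alpha>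
  proof -
    obtain \<beta> where \<beta>: "\<beta> \<in> rooted_graphs D" "verts (fst \<beta>) \<subseteq> {..<Suc D ^ s}"
        "rooted_iso (rooted_ball (fst \<alpha>) s (snd \<alpha>)) \<beta>"
      using rooted_ball_class[OF rooted_graphsD(1,4,5)[OF \<alpha>(1)]] by blast
    then have "rooted_iso \<alpha> \<beta>" using rooted_ball_graph_radius[OF \<alpha>(1)] \<alpha>(2) by simp
    moreover have "graph_radius \<beta> = s"
      using graph_radius_iso[OF _ _ _ calculation] rooted_graphsD[OF \<alpha>(1)] rooted_graphsD[OF \<beta>(1)] \<alpha>(2)
      by simp
    ultimately show ?thesis using \<beta>(1,2) by (intro bexI[of _ \<beta>]) (simp_all add: F_def)
  qed
  have c: "c \<alpha> \<in> F" "rooted_iso \<alpha> (c \<alpha>)" if "\<alpha> \<in> F" for \<alpha>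
  proof -
    have "\<exists>\<beta>. \<beta> \<in> F \<and> rooted_iso \<alpha> \<beta>" using that rooted_iso_refl[of \<alpha>] by blast
    from someI_ex[OF this] show "c \<alpha> \<in> F" "rooted_iso \<alpha> (c \<alpha>)" by (simp_all add: c_def)
  qed
  \<comment> \<open>Isomorphic graphs satisfy the same description, and \<open>SOME\<close> depends on nothing else.\<close>
  have cong: "c \<alpha> = c \<beta>" if "\<alpha> \<in> F" "\<beta> \<in> F" "rooted_iso \<alpha> \<beta>" for \<alpha> \<beta>
  proof -
    note D = FD[OF that(1)] FD[OF that(2)]
    have "(\<gamma> \<in> F \<and> rooted_iso \<alpha> \<gamma>) = (\<gamma> \<in> F \<and> rooted_iso \<beta> \<gamma>)" for \<gamma>
    proof (intro conj_cong refl iffI)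
      assume \<gamma>: "\<gamma> \<in> F"
      show "rooted_iso \<beta> \<gamma>" if "rooted_iso \<alpha> \<gamma>"
        by (rule trans[OF D(2,1) FD[OF \<gamma>] sym[OF D \<open>rooted_iso \<alpha> \<beta>\<close>] that])
      show "rooted_iso \<alpha> \<gamma>" if "rooted_iso \<beta> \<gamma>"
        by (rule trans[OF D FD[OF \<gamma>] \<open>rooted_iso \<alpha> \<beta>\<close> that])
    qed
    then show ?thesis by (simp add: c_def)
  qed
  have "finite F"
    by (rule finite_subset[OF _ finite_rooted_graphs_on[of "{..<Suc D ^ s}" D]])
      (auto simp: F_def)
  moreover have "\<exists>\<beta>\<in>c ` F. \<forall>\<gamma>\<in>c ` F. rooted_iso \<alpha> \<gamma> \<longleftrightarrow> \<gamma> = \<beta>"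
    if \<alpha>: "\<alpha> \<in> rooted_graphs D" "graph_radius \<alpha> = s" for \<alpha>
  proof -
    obtain \<beta> where \<beta>: "\<beta> \<in> F" "rooted_iso \<alpha> \<beta>" using exF[OF \<alpha>] by blast
    have "rooted_iso \<alpha> \<gamma> \<longleftrightarrow> \<gamma> = c \<beta>" if im: "\<gamma> \<in> c ` F" for \<gamma>
    proof
      assume iso: "rooted_iso \<alpha> \<gamma>"
      obtain \<delta> where \<delta>: "\<delta> \<in> F" "\<gamma> = c \<delta>" using im by blast
      have \<gamma>: "\<gamma> \<in> F" "rooted_iso \<delta> \<gamma>" using c[OF \<delta>(1)] \<delta>(2) by auto
      have "rooted_iso \<gamma> \<alpha>" using sym[OF \<alpha>(1) FD[OF \<gamma>(1)] iso] .
      then have "rooted_iso \<delta> \<beta>"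
        by (intro trans[OF FD[OF \<delta>(1)] FD[OF \<gamma>(1)] FD[OF \<beta>(1)] \<gamma>(2)]
          trans[OF FD[OF \<gamma>(1)] \<alpha>(1) FD[OF \<beta>(1)] _ \<beta>(2)])
      then show "\<gamma> = c \<beta>" using cong[OF \<delta>(1) \<beta>(1)] \<delta>(2) by simp
    next
      assume "\<gamma> = c \<beta>"
      then show "rooted_iso \<alpha> \<gamma>"
        using trans[OF \<alpha>(1) FD[OF \<beta>(1)] FD[OF c(1)[OF \<beta>(1)]] \<beta>(2) c(2)[OF \<beta>(1)]] by simp
    qed
    then show ?thesis by (intro bexI[of _ "c \<beta>"] ballI imageI \<beta>(1))
  qed
  moreover have "c ` F \<subseteq> {\<alpha> \<in> rooted_graphs D. graph_radius \<alpha> = s}" using c by (auto simp: F_def)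
  ultimately show ?thesis by (intro exI[of _ "c ` F"] conjI ballI impI finite_imageI)
qed

text \<open>One representative for each class of radius \<open>s\<close>, so that a sum over \<open>class_reps D s\<close> counts a
  ball only once.\<close>

definition class_reps :: "nat \<Rightarrow> nat \<Rightarrow> (nat graph \<times> nat) set" where
  "class_reps D s = (SOME T. finite T \<and> T \<subseteq> {\<alpha> \<in> rooted_graphs D. graph_radius \<alpha> = s} \<and>
     (\<forall>\<alpha>\<in>rooted_graphs D. graph_radius \<alpha> = s \<longrightarrow>
        (\<exists>\<beta>\<in>T. \<forall>\<gamma>\<in>T. rooted_iso \<alpha> \<gamma> \<longleftrightarrow> \<gamma> = \<beta>)))"

lemma
  shows finite_class_reps: "finite (class_reps D s)"
    and class_reps_subset: "class_reps D s \<subseteq> {\<alpha> \<in> rooted_graphs D. graph_radius \<alpha> = s}"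
    and class_reps_cover: "\<forall>\<alpha>\<in>rooted_graphs D. graph_radius \<alpha> = s \<longrightarrow>
      (\<exists>\<beta>\<in>class_reps D s. \<forall>\<gamma>\<in>class_reps D s. rooted_iso \<alpha> \<gamma> \<longleftrightarrow> \<gamma> = \<beta>)"
proof -
  note T = someI_ex[OF class_representatives_exist[of D s], folded class_reps_def]
  show "finite (class_reps D s)" using T by (rule conjunct1)
  show "class_reps D s \<subseteq> {\<alpha> \<in> rooted_graphs D. graph_radius \<alpha> = s}"
    using T[THEN conjunct2] by (rule conjunct1)
  show "\<forall>\<alpha>\<in>rooted_graphs D. graph_radius \<alpha> = s \<longrightarrow>
      (\<exists>\<beta>\<in>class_reps D s. \<forall>\<gamma>\<in>class_reps D s. rooted_iso \<alpha> \<gamma> \<longleftrightarrow> \<gamma> = \<beta>)"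
    using T[THEN conjunct2] by (rule conjunct2)
qed

lemma class_repsD:
  assumes "\<alpha> \<in> class_reps D s"
  shows "\<alpha> \<in> rooted_graphs D" "graph_radius \<alpha> = s"
  using class_reps_subset[of D s] assms by auto

text \<open>A vertex of the ball of radius \<open>s + 1\<close> outside the ball of radius \<open>s\<close> has distance \<open>s + 1\<close>
  from the centre. If there is one, the larger ball has radius exactly \<open>s + 1\<close>, as the classes in
  \<open>class_reps D (Suc s)\<close> have; otherwise its radius is at most \<open>s\<close>.\<close>

lemma unique_class_of_growing_ball:
  assumes "is_graph G" "degree_bounded D G" "x \<in> verts G"
    and "ball_verts G (Suc s) x \<noteq> ball_verts G s x"
  shows "\<exists>\<beta>\<in>class_reps D (Suc s). \<forall>\<gamma>\<in>class_reps D (Suc s).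
    rooted_iso (rooted_ball G (Suc s) x) \<gamma> \<longleftrightarrow> \<gamma> = \<beta>"
proof -
  let ?B = "rooted_ball G (Suc s) x"
  have B: "is_graph (fst ?B)" "snd ?B \<in> verts (fst ?B)"
    using is_graph_rooted_ball[OF assms(1)] root_in_ball[OF assms(3)] by auto
  have fin: "finite (ball_verts G (Suc s) x)" using ball_verts_card[OF assms(1-3)] by blast
  have rad: "graph_radius ?B = Suc s"
    using graph_radius_rooted_ball_le_iff[OF assms(1,3) fin, of s]
      graph_radius_rooted_ball_le_iff[OF assms(1,3) fin, of "Suc s"] assms(4) by auto
  obtain \<alpha> where \<alpha>: "\<alpha> \<in> rooted_graphs D" "rooted_iso ?B \<alpha>"
    using rooted_ball_class[OF assms(1-3)] by blast
  have "graph_radius \<alpha> = Suc s"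
    using graph_radius_iso[OF B(1) rooted_graphsD(1)[OF \<alpha>(1)] B(2) \<alpha>(2)] rad by simp
  then obtain \<beta> where \<beta>: "\<beta> \<in> class_reps D (Suc s)"
      "\<And>\<gamma>. \<gamma> \<in> class_reps D (Suc s) \<Longrightarrow> rooted_iso \<alpha> \<gamma> \<longleftrightarrow> \<gamma> = \<beta>"
    using class_reps_cover \<alpha>(1) by blast
  have "rooted_iso ?B \<gamma> \<longleftrightarrow> rooted_iso \<alpha> \<gamma>" if "\<gamma> \<in> class_reps D (Suc s)" for \<gamma>
  proof -
    have \<gamma>: "is_graph (fst \<gamma>)" by (rule rooted_graphsD(1)[OF class_repsD(1)[OF that]])
    note \<alpha>' = rooted_graphsD[OF \<alpha>(1)]
    show ?thesis
      using rooted_iso_trans[OF B(1) \<alpha>'(1) \<gamma> \<alpha>(2)]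
        rooted_iso_trans[OF \<alpha>'(1) B(1) \<gamma> rooted_iso_sym[OF B(1) \<alpha>'(1) B(2) \<alpha>(2)]] by blast
  qed
  then show ?thesis using \<beta> by auto
qed

lemma no_class_of_stationary_ball:
  assumes "is_graph G" "degree_bounded D G" "x \<in> verts G"
    and "ball_verts G (Suc s) x = ball_verts G s x" and "\<beta> \<in> class_reps D (Suc s)"
  shows "\<not> rooted_iso (rooted_ball G (Suc s) x) \<beta>"
proof
  let ?B = "rooted_ball G (Suc s) x"
  assume iso: "rooted_iso ?B \<beta>"
  have \<beta>: "is_graph (fst \<beta>)" "graph_radius \<beta> = Suc s"
    by (rule rooted_graphsD(1)[OF class_repsD(1)[OF assms(5)]], rule class_repsD(2)[OF assms(5)])
  have B: "is_graph (fst ?B)" "snd ?B \<in> verts (fst ?B)"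
    using is_graph_rooted_ball[OF assms(1)] root_in_ball[OF assms(3)] by auto
  have fin: "finite (ball_verts G (Suc s) x)" using ball_verts_card[OF assms(1-3)] by blast
  have "graph_radius ?B \<le> s"
    using graph_radius_rooted_ball_le_iff[OF assms(1,3) fin, of s] assms(4) by auto
  then show False using graph_radius_iso[OF B(1) \<beta>(1) B(2) iso] \<beta>(2) by simp
qed

section \<open>Reduced closed paths as a local statistic\<close>

text \<open>Counting from \<open>0\<close>, the \<open>i\<close>-th edge of a path starting at \<open>x\<close> begins at distance at most \<open>i\<close> from \<open>x\<close>, so
  closed paths of length \<open>j\<close> are seen in every ball of radius at least \<open>j\<close>.\<close>

lemma reduced_closed_path_rooted_ball:
  assumes G: "is_graph G" and x: "x \<in> verts G" and "j \<le> r"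
  shows "reduced_closed_path (fst (rooted_ball G r x)) j x es \<longleftrightarrow> reduced_closed_path G j x es"
proof
  assume "reduced_closed_path (fst (rooted_ball G r x)) j x es"
  then show "reduced_closed_path G j x es" by (auto simp: reduced_closed_path_def)
next
  assume p: "reduced_closed_path G j x es"
  have E: "es ! i \<in> edges G" if "i < j" for i
    using p that by (auto simp: reduced_closed_path_def)
  have start: "(x, fst (es ! i)) \<in> edges G ^^ i" if "i < j" for i
    using that
  proof (induction i)
    case 0
    then show ?case using p by (auto simp: reduced_closed_path_def hd_conv_nth)
  next
    case (Suc i)
    then have "snd (es ! i) = fst (es ! Suc i)" using p by (auto simp: reduced_closed_path_def)
    then have "(fst (es ! i), fst (es ! Suc i)) \<in> edges G" using E[of i] Suc.prems by (metis Suc_lessD prod.collapse)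
    then show ?case using Suc by auto
  qed
  have "e \<in> edges (fst (rooted_ball G r x))" if "e \<in> set es" for e
  proof -
    obtain i where i: "i < j" "e = es ! i"
      using p \<open>e \<in> set es\<close> by (auto simp: in_set_conv_nth reduced_closed_path_def)
    obtain a b where ab: "es ! i = (a, b)" by fastforce
    have a: "(x, a) \<in> edges G ^^ i" using start[OF i(1)] ab by simp
    have e: "(a, b) \<in> edges G" using E[OF i(1)] ab by simp
    have "(x, b) \<in> edges G ^^ Suc i" using a e by auto
    then have "b \<in> ball_verts G r x"
      using relpow_verts[OF G x, of b "Suc i"] i(1) assms(3) unfolding ball_verts_def
      by (intro CollectI conjI exI[of _ "Suc i"]) auto
    moreover have "a \<in> ball_verts G r x"
      using relpow_verts[OF G x a] a i(1) assms(3) unfolding ball_verts_def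
      by (intro CollectI conjI exI[of _ i]) auto
    ultimately show ?thesis using e ab i(2) by simp
  qed
  then show "reduced_closed_path (fst (rooted_ball G r x)) j x es"
    using p unfolding reduced_closed_path_def by blast
qed

lemma num_reduced_rooted_ball:
  assumes "is_graph G" "x \<in> verts G" "j \<le> r"
  shows "num_reduced (fst (rooted_ball G r x)) j x = num_reduced G j x"
  using reduced_closed_path_rooted_ball[OF assms] by (simp add: num_reduced_def)

text \<open>The start of the telescoping sum: a single vertex has no edges.\<close>

lemma num_reduced_rooted_ball_0:
  assumes "is_graph G" "x \<in> verts G"
  shows "num_reduced (fst (rooted_ball G 0 x)) j x = 0"
proof -
  have "edges (fst (rooted_ball G 0 x)) = {}"
    using assms(1) by (auto simp: ball_verts_def is_graph_def irrefl_def)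
  then show ?thesis by (simp add: num_reduced_def reduced_closed_path_def)
qed

lemma reduced_closed_path_iso:
  assumes f: "graph_iso f A B" and x: "x \<in> verts A" and p: "reduced_closed_path A j x es"
  shows "reduced_closed_path B j (f x) (map (map_prod f f) es)"
proof -
  let ?F = "map_prod f f"
  have inj: "inj_on f (verts A)" using f by (simp add: graph_iso_def bij_betw_def)
  have es: "es \<noteq> []" "length es = j" "set es \<subseteq> edges A" using p by (auto simp: reduced_closed_path_def)
  have E: "e \<in> verts A \<times> verts A" "?F e \<in> edges B" if "e \<in> edges A" for e
    using that f graph_iso_edge[OF f] by (cases e; auto simp: graph_iso_def is_graph_def)+
  have rev: "?F e = prod.swap (?F e') \<longleftrightarrow> e = prod.swap e'" if "e \<in> edges A" "e' \<in> edges A" for e e'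
    using E(1)[OF that(1)] E(1)[OF that(2)] inj
    by (cases e; cases e') (auto dest: inj_onD)
  have nth: "es ! i \<in> edges A" if "i < j" for i using es that by auto
  have ends: "hd es \<in> edges A" "last es \<in> edges A" using es by auto
  have swap: "prod.swap (hd es) \<noteq> last es \<longleftrightarrow> last es \<noteq> prod.swap (hd es)"
    "prod.swap (?F (hd es)) \<noteq> ?F (last es) \<longleftrightarrow> ?F (last es) \<noteq> prod.swap (?F (hd es))" by auto
  show ?thesis
    using p E(2) nth unfolding reduced_closed_path_def
    by (auto simp: es(2) hd_map last_map rev swap ends subset_iff)
qed

lemma num_reduced_iso:
  assumes "is_graph (fst \<alpha>)" "is_graph (fst \<beta>)" "snd \<alpha> \<in> verts (fst \<alpha>)" "rooted_iso \<alpha> \<beta>"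
  shows "num_reduced (fst \<alpha>) j (snd \<alpha>) = num_reduced (fst \<beta>) j (snd \<beta>)"
proof -
  obtain f where f: "graph_iso f (fst \<alpha>) (fst \<beta>)" "f (snd \<alpha>) = snd \<beta>"
    using assms rooted_iso_iff by blast
  define g where "g = inv_into (verts (fst \<alpha>)) f"
  have g: "graph_iso g (fst \<beta>) (fst \<alpha>)" unfolding g_def by (rule graph_iso_inverse[OF f(1)])
  have bij: "bij_betw f (verts (fst \<alpha>)) (verts (fst \<beta>))" using f(1) by (simp add: graph_iso_def)
  have gf: "g (f v) = v" if "v \<in> verts (fst \<alpha>)" for v
    unfolding g_def by (rule graph_iso_inv_into[OF f(1) that])
  have fg: "f (g w) = w" if "w \<in> verts (fst \<beta>)" for w
    unfolding g_def using bij_betw_inv_into_right[OF bij that] .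
  have root: "snd \<beta> \<in> verts (fst \<beta>)" "g (snd \<beta>) = snd \<alpha>"
    using graph_iso_mem[OF f(1) assms(3)] gf[OF assms(3)] f(2) by auto
  let ?P = "\<lambda>\<alpha>. {es. reduced_closed_path (fst \<alpha>) j (snd \<alpha>) es}"
  have gf': "map_prod g g (map_prod f f e) = e" if "e \<in> edges (fst \<alpha>)" for e
    using that assms(1) gf by (cases e) (auto simp: is_graph_def)
  have fg': "map_prod f f (map_prod g g e) = e" if "e \<in> edges (fst \<beta>)" for e
    using that assms(2) fg by (cases e) (auto simp: is_graph_def)
  have "bij_betw (map (map_prod f f)) (?P \<alpha>) (?P \<beta>)"
  proof (rule bij_betw_byWitness[where f' = "map (map_prod g g)"])
    show "\<forall>es\<in>?P \<alpha>. map (map_prod g g) (map (map_prod f f) es) = es"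
      using gf' unfolding reduced_closed_path_def by (auto simp: o_def subset_iff intro!: map_idI)
    show "\<forall>es\<in>?P \<beta>. map (map_prod f f) (map (map_prod g g) es) = es"
      using fg' unfolding reduced_closed_path_def by (auto simp: o_def subset_iff intro!: map_idI)
    show "map (map_prod f f) ` ?P \<alpha> \<subseteq> ?P \<beta>"
      using reduced_closed_path_iso[OF f(1) assms(3), of j] f(2) by auto
    show "map (map_prod g g) ` ?P \<beta> \<subseteq> ?P \<alpha>"
      using reduced_closed_path_iso[OF g root(1), of j] root(2) by auto
  qed
  then show ?thesis unfolding num_reduced_def by (rule bij_betw_same_card)
qed

text \<open>The paths have length \<open>m + 1\<close>: first the edge \<open>e\<close>, then \<open>m\<close> more. At the end they need not close
  up, so this counts more than the reduced closed paths.\<close>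

fun nonbacktracking_paths :: "'a graph \<Rightarrow> nat \<Rightarrow> 'a \<times> 'a \<Rightarrow> ('a \<times> 'a) list set" where
  "nonbacktracking_paths G 0 e = {[e]}"
| "nonbacktracking_paths G (Suc m) e =
     (\<Union>e'\<in>{e' \<in> edges G. fst e' = snd e \<and> e' \<noteq> prod.swap e}. (#) e ` nonbacktracking_paths G m e')"

lemma nonbacktracking_pathsI:
  assumes "length es = Suc m" "set es \<subseteq> edges G"
    "\<And>i. Suc i < length es \<Longrightarrow> snd (es ! i) = fst (es ! Suc i) \<and> es ! Suc i \<noteq> prod.swap (es ! i)"
  shows "es \<in> nonbacktracking_paths G m (hd es)"
  using assms
proof (induction m arbitrary: es)
  case 0
  then show ?case by (cases es) auto
next
  case (Suc m)
  then obtain e e' fs where es: "es = e # e' # fs" by (cases es; cases "tl es") auto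
  have "e' # fs \<in> nonbacktracking_paths G m (hd (e' # fs))"
  proof (rule Suc.IH)
    fix i assume "Suc i < length (e' # fs)"
    then show "snd ((e' # fs) ! i) = fst ((e' # fs) ! Suc i) \<and>
        (e' # fs) ! Suc i \<noteq> prod.swap ((e' # fs) ! i)"
      using Suc.prems(3)[of "Suc i"] es by simp
  qed (use Suc.prems es in auto)
  moreover have "snd e = fst e'" "e' \<noteq> prod.swap e" using Suc.prems(3)[of 0] es by auto
  ultimately show ?case using Suc.prems(2) es unfolding nonbacktracking_paths.simps
    by (intro UN_I[of e']) auto
qed

text \<open>After the first edge, each further edge of a path without backtracking is one of at most
  \<open>D - 1\<close>: the edges leaving its origin, except the reversal of the edge before.\<close>

lemma card_nonbacktracking_paths:
  assumes G: "is_graph G" "degree_bounded D G" and "e \<in> edges G"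
  shows "finite (nonbacktracking_paths G m e) \<and> card (nonbacktracking_paths G m e) \<le> (D - 1) ^ m"
  using assms(3)
proof (induction m arbitrary: e)
  case (Suc m)
  let ?N = "{e' \<in> edges G. fst e' = snd e \<and> e' \<noteq> prod.swap e}"
  let ?W = "edges G `` {snd e} - {fst e}"
  have "snd e \<in> verts G" "fst e \<in> edges G `` {snd e}"
    using G(1) Suc.prems by (cases e; auto simp: is_graph_def sym_def)+
  then have W: "finite ?W" "card ?W \<le> D - 1"
    using G(2) by (auto simp: degree_bounded_def intro!: diff_le_mono)
  have sub: "?N \<subseteq> Pair (snd e) ` ?W" by (cases e) auto
  have N: "finite ?N" "card ?N \<le> D - 1"
    using finite_subset[OF sub] surj_card_le[OF W(1) sub] W by auto
  have IH: "finite (nonbacktracking_paths G m e')" "card (nonbacktracking_paths G m e') \<le> (D - 1) ^ m"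
    if "e' \<in> ?N" for e'
    using Suc.IH[of e'] that by auto
  have "card (nonbacktracking_paths G (Suc m) e) \<le> (\<Sum>e'\<in>?N. card ((#) e ` nonbacktracking_paths G m e'))"
    unfolding nonbacktracking_paths.simps by (rule card_UN_le[OF N(1)])
  also have "\<dots> \<le> (\<Sum>e'\<in>?N. (D - 1) ^ m)"
    by (intro sum_mono order.trans[OF card_image_le]) (use IH in auto)
  also have "\<dots> = card ?N * (D - 1) ^ m" by simp
  also have "\<dots> \<le> (D - 1) ^ Suc m" using N(2) by (simp add: mult_right_mono)
  finally show ?case using N(1) IH by auto
qed auto

lemma num_reduced_le:
  assumes G: "is_graph G" "degree_bounded D G" and x: "x \<in> verts G"
  shows "num_reduced G (Suc m) x \<le> D * (D - 1) ^ m"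
proof -
  let ?S = "Pair x ` (edges G `` {x})"
  have S: "finite ?S" "card ?S \<le> D"
    using G(2) x card_image_le[of "edges G `` {x}" "Pair x"] by (auto simp: degree_bounded_def intro: le_trans)
  have SE: "e \<in> edges G" if "e \<in> ?S" for e using that by auto
  have sub: "{es. reduced_closed_path G (Suc m) x es} \<subseteq> (\<Union>e\<in>?S. nonbacktracking_paths G m e)"
  proof clarify
    fix es assume p: "reduced_closed_path G (Suc m) x es"
    then have "hd es \<in> edges G" "fst (hd es) = x" by (auto simp: reduced_closed_path_def)
    then have "hd es \<in> ?S" by (cases "hd es") auto
    moreover have "es \<in> nonbacktracking_paths G m (hd es)"
      by (rule nonbacktracking_pathsI) (use p in \<open>auto simp: reduced_closed_path_def\<close>)
    ultimately show "es \<in> (\<Union>e\<in>?S. nonbacktracking_paths G m e)" by blast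
  qed
  have "num_reduced G (Suc m) x \<le> card (\<Union>e\<in>?S. nonbacktracking_paths G m e)"
    unfolding num_reduced_def
    using card_mono[OF _ sub] S(1) SE card_nonbacktracking_paths[OF G] by blast
  also have "\<dots> \<le> (\<Sum>e\<in>?S. card (nonbacktracking_paths G m e))" by (rule card_UN_le[OF S(1)])
  also have "\<dots> \<le> (\<Sum>e\<in>?S. (D - 1) ^ m)"
    using SE card_nonbacktracking_paths[OF G] by (intro sum_mono) blast
  also have "\<dots> \<le> D * (D - 1) ^ m" using S(2) by simp
  finally show ?thesis .
qed

section \<open>Path numbers in terms of ball frequencies\<close>

text \<open>For \<open>\<alpha>\<close> of radius \<open>s + 1\<close>: the number of paths that use the outermost layer of \<open>\<alpha>\<close>.\<close>

definition path_gain :: "nat \<Rightarrow> nat \<Rightarrow> 'a graph \<times> 'a \<Rightarrow> real" where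
  "path_gain j s \<alpha> = real (num_reduced (fst \<alpha>) j (snd \<alpha>)) -
     real (num_reduced (fst (rooted_ball (fst \<alpha>) s (snd \<alpha>))) j (snd \<alpha>))"

text \<open>If the ball of radius \<open>s + 1\<close> represents the class of \<open>\<alpha>\<close>, then its path number and that of
  the smaller ball can be computed in \<open>\<alpha>\<close>.  If no class of radius \<open>s + 1\<close> is represented, the ball
  has stopped growing, and there is no change.\<close>

lemma num_reduced_ball_Suc:
  assumes G: "is_graph G" "degree_bounded D G" and x: "x \<in> verts G"
  shows "real (num_reduced (fst (rooted_ball G (Suc s) x)) j x) -
      real (num_reduced (fst (rooted_ball G s x)) j x) =
    (\<Sum>\<alpha>\<in>class_reps D (Suc s). path_gain j s \<alpha> * of_bool (rooted_iso (rooted_ball G (Suc s) x) \<alpha>))"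
proof (cases "ball_verts G (Suc s) x = ball_verts G s x")
  case True
  then have "rooted_ball G (Suc s) x = rooted_ball G s x" by (simp add: rooted_ball_def)
  moreover have "(\<Sum>\<alpha>\<in>class_reps D (Suc s). path_gain j s \<alpha> *
      of_bool (rooted_iso (rooted_ball G (Suc s) x) \<alpha>)) = (0::real)"
    using no_class_of_stationary_ball[OF G x True] by (intro sum.neutral) auto
  ultimately show ?thesis by simp
next
  case False
  let ?B = "rooted_ball G (Suc s) x"
  obtain \<beta> where \<beta>: "\<beta> \<in> class_reps D (Suc s)"
    "\<And>\<gamma>. \<gamma> \<in> class_reps D (Suc s) \<Longrightarrow> rooted_iso ?B \<gamma> \<longleftrightarrow> \<gamma> = \<beta>"
    using unique_class_of_growing_ball[OF G x False] by blast
  have "(\<Sum>\<alpha>\<in>class_reps D (Suc s). path_gain j s \<alpha> * of_bool (rooted_iso ?B \<alpha>)) =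
      (\<Sum>\<alpha>\<in>class_reps D (Suc s). if \<alpha> = \<beta> then path_gain j s \<beta> else 0)"
    using \<beta>(2) by (intro sum.cong) auto
  also have "\<dots> = path_gain j s \<beta>" using \<beta>(1) finite_class_reps[of D "Suc s"] by simp
  finally have sum: "(\<Sum>\<alpha>\<in>class_reps D (Suc s). path_gain j s \<alpha> * of_bool (rooted_iso ?B \<alpha>)) =
      path_gain j s \<beta>" .
  have B: "is_graph (fst ?B)" "snd ?B \<in> verts (fst ?B)"
    using is_graph_rooted_ball[OF G(1)] root_in_ball[OF x] by auto
  have \<beta>': "is_graph (fst \<beta>)" by (rule rooted_graphsD(1)[OF class_repsD(1)[OF \<beta>(1)]])
  have iso: "rooted_iso ?B \<beta>" using \<beta> by simp
  have "rooted_ball (fst ?B) s x = rooted_ball G s x"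
    by (rule rooted_ball_rooted_ball[OF G(1) x]) simp
  then have smaller: "rooted_iso (rooted_ball G s x) (rooted_ball (fst \<beta>) s (snd \<beta>))"
    using rooted_ball_iso[OF B(1) \<beta>' B(2) iso, of s] by simp
  have "num_reduced (fst ?B) j x = num_reduced (fst \<beta>) j (snd \<beta>)"
    using num_reduced_iso[OF B(1) \<beta>' B(2) iso, of j] by simp
  moreover have "num_reduced (fst (rooted_ball G s x)) j x =
      num_reduced (fst (rooted_ball (fst \<beta>) s (snd \<beta>))) j (snd \<beta>)"
    using num_reduced_iso[OF is_graph_rooted_ball[OF G(1)] is_graph_rooted_ball[OF \<beta>'] _ smaller, of j]
      root_in_ball[OF x, of s] by simp
  ultimately show ?thesis unfolding sum by (simp add: path_gain_def)
qed

text \<open>The classes and coefficients depend on \<open>D\<close> and \<open>j\<close> only. Hence the same formula may be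
  averaged over each \<open>G_n\<close> and integrated over a graphing.\<close>

lemma num_reduced_eq_sum_classes:
  assumes G: "is_graph G" "degree_bounded D G" and x: "x \<in> verts G"
  shows "real (num_reduced G j x) =
    (\<Sum>s<j. \<Sum>\<alpha>\<in>class_reps D (Suc s).
       path_gain j s \<alpha> * of_bool (rooted_iso (rooted_ball G (Suc s) x) \<alpha>))"
proof -
  let ?N = "\<lambda>r. real (num_reduced (fst (rooted_ball G r x)) j x)"
  have "real (num_reduced G j x) = ?N j - ?N 0"
    using num_reduced_rooted_ball[OF G(1) x order.refl, of j] num_reduced_rooted_ball_0[OF G(1) x, of j]
    by simp
  also have "\<dots> = (\<Sum>s<j. ?N (Suc s) - ?N s)" by (rule sum_lessThan_telescope[symmetric])
  finally show ?thesis using num_reduced_ball_Suc[OF G x] by simp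
qed

lemma ball_freq_eq_sum:
  assumes "finite (verts G)" "\<alpha> \<in> class_reps D s"
  shows "ball_freq G \<alpha> =
    (\<Sum>x\<in>verts G. of_bool (rooted_iso (rooted_ball G s x) \<alpha>)) / real (card (verts G))"
  using assms by (simp add: ball_freq_def class_repsD(2) Int_def)

lemma mean_num_reduced_eq_ball_freq:
  assumes G: "is_graph G" "degree_bounded D G" "finite (verts G)"
  shows "1 / real (card (verts G)) * (\<Sum>x\<in>verts G. real (num_reduced G j x)) =
    (\<Sum>s<j. \<Sum>\<alpha>\<in>class_reps D (Suc s). path_gain j s \<alpha> * ball_freq G \<alpha>)"
proof -
  have "(\<Sum>x\<in>verts G. real (num_reduced G j x)) =
      (\<Sum>x\<in>verts G. \<Sum>s<j. \<Sum>\<alpha>\<in>class_reps D (Suc s).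
         path_gain j s \<alpha> * of_bool (rooted_iso (rooted_ball G (Suc s) x) \<alpha>))"
    using num_reduced_eq_sum_classes[OF G(1,2)] by (intro sum.cong refl)
  also have "\<dots> = (\<Sum>s<j. \<Sum>\<alpha>\<in>class_reps D (Suc s). \<Sum>x\<in>verts G.
         path_gain j s \<alpha> * of_bool (rooted_iso (rooted_ball G (Suc s) x) \<alpha>))"
    by (subst sum.swap) (intro sum.cong refl sum.swap)
  finally show ?thesis
    by (simp add: ball_freq_eq_sum[OF G(3)] flip: sum_divide_distrib sum_distrib_left)
qed

text \<open>In a connected graph with more than one vertex each vertex has a neighbour, so that each ball of
  radius \<open>1\<close> grows beyond its centre.\<close>

lemma sum_ball_freq_radius_1:
  assumes G: "is_graph G" "degree_bounded D G" "finite (verts G)" "graph_connected G"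
    and "card (verts G) \<noteq> 1"
  shows "(\<Sum>\<alpha>\<in>class_reps D 1. ball_freq G \<alpha>) = 1"
proof -
  have one: "(\<Sum>\<alpha>\<in>class_reps D 1. of_bool (rooted_iso (rooted_ball G 1 x) \<alpha>)) = (1::real)"
    if x: "x \<in> verts G" for x
  proof -
    obtain y where y: "y \<in> verts G" "y \<noteq> x"
      using assms(5) x by (cases "verts G = {x}") auto
    have "(x, y) \<in> (edges G)\<^sup>*" using G(4) x y by (simp add: graph_connected_def)
    then obtain z where z: "(x, z) \<in> edges G" using y(2) by (blast elim: converse_rtranclE)
    have "x \<noteq> z" "z \<in> verts G" using z G(1) by (auto simp: is_graph_def irrefl_def)
    moreover have "(x, z) \<in> edges G ^^ 1" using z by simp
    ultimately have "z \<in> ball_verts G 1 x" unfolding ball_verts_def by blast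
    moreover have "z \<notin> ball_verts G 0 x" using \<open>x \<noteq> z\<close> by (auto simp: ball_verts_def)
    ultimately have "ball_verts G (Suc 0) x \<noteq> ball_verts G 0 x" by auto
    from unique_class_of_growing_ball[OF G(1,2) x this]
    obtain \<beta> where \<beta>: "\<beta> \<in> class_reps D 1"
      "\<And>\<gamma>. \<gamma> \<in> class_reps D 1 \<Longrightarrow> rooted_iso (rooted_ball G 1 x) \<gamma> \<longleftrightarrow> \<gamma> = \<beta>"
      by auto
    have "(\<Sum>\<alpha>\<in>class_reps D 1. of_bool (rooted_iso (rooted_ball G 1 x) \<alpha>)) =
        (\<Sum>\<alpha>\<in>class_reps D 1. if \<alpha> = \<beta> then 1 else (0::real))"
      using \<beta>(2) by (intro sum.cong) auto
    then show ?thesis using \<beta>(1) finite_class_reps[of D 1] by simp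
  qed
  have "(\<Sum>\<alpha>\<in>class_reps D 1. ball_freq G \<alpha>) =
      (\<Sum>\<alpha>\<in>class_reps D 1. \<Sum>x\<in>verts G. of_bool (rooted_iso (rooted_ball G 1 x) \<alpha>)) /
        real (card (verts G))"
    by (simp add: ball_freq_eq_sum[OF G(3)] sum_divide_distrib)
  also have "\<dots> = (\<Sum>x\<in>verts G. 1) / real (card (verts G))"
    using one by (subst sum.swap) simp
  also have "\<dots> = 1" using G(3,4) by (simp add: graph_connected_def)
  finally show ?thesis .
qed

section \<open>Orbit graphs of a graphing\<close>

text \<open>The ball of radius \<open>1\<close> contains all neighbours of its centre.\<close>

lemma card_neighbours_le_of_class:
  assumes "is_graph G" "x \<in> verts G" "\<alpha> \<in> rooted_graphs D" "rooted_iso (rooted_ball G 1 x) \<alpha>"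
  shows "card (edges G `` {x}) \<le> D"
proof -
  let ?B = "rooted_ball G 1 x"
  have B: "is_graph (fst ?B)" "snd ?B \<in> verts (fst ?B)"
    using is_graph_rooted_ball[OF assms(1)] root_in_ball[OF assms(2)] by auto
  note \<alpha> = rooted_graphsD[OF assms(3)]
  obtain f where "graph_iso f (fst \<alpha>) (fst ?B)"
    using rooted_iso_sym[OF B(1) \<alpha>(1) B(2) assms(4)] rooted_iso_iff[OF \<alpha>(1) B(1)] by blast
  then have "degree_bounded D (fst ?B)" using degree_bounded_iso \<alpha>(4) by blast
  moreover have "edges (fst ?B) `` {x} = edges G `` {x}"
  proof -
    have "y \<in> ball_verts G 1 x" if "(x, y) \<in> edges G" for y
    proof -
      have "(x, y) \<in> edges G ^^ 1" using that by simp
      moreover have "y \<in> verts G" using that assms(1) by (auto simp: is_graph_def)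
      ultimately show ?thesis unfolding ball_verts_def by blast
    qed
    then show ?thesis using root_in_ball[OF assms(2)] by auto
  qed
  ultimately show ?thesis using B(2) by (auto simp: degree_bounded_def)
qed

locale graphing =
  fixes X :: "('b :: metric_space) graphing"
  assumes is_graphing: "is_graphing X"
begin

abbreviation "S \<equiv> gr_space X"
abbreviation "M \<equiv> gr_measure X"
abbreviation "walk ks x \<equiv> foldr (gr_invol X) ks x"
abbreviation "words \<equiv> {ks. set ks \<subseteq> {..<gr_num X}}"

lemma
  shows invol_mem: "k < gr_num X \<Longrightarrow> x \<in> S \<Longrightarrow> gr_invol X k x \<in> S"
    and invol_invol: "k < gr_num X \<Longrightarrow> x \<in> S \<Longrightarrow> gr_invol X k (gr_invol X k x) = x"
    and continuous_on_invol: "k < gr_num X \<Longrightarrow> continuous_on S (gr_invol X k)"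
    and distr_invol: "k < gr_num X \<Longrightarrow> distr M M (gr_invol X k) = M"
    and sets_M: "sets M = sets (restrict_space borel S)"
    and prob_space_M: "prob_space M"
  using is_graphing by (auto simp: is_graphing_def)

sublocale prob_space M by (rule prob_space_M)

lemma space_M: "space M = S"
  using sets_eq_imp_space_eq[OF sets_M] by (simp add: space_restrict_space)

lemma walk_mem: "ks \<in> words \<Longrightarrow> x \<in> S \<Longrightarrow> walk ks x \<in> S"
  by (induction ks) (auto intro: invol_mem)

lemma walk_rev:
  assumes "ks \<in> words" "x \<in> S"
  shows "walk (rev ks) (walk ks x) = x"
  using assms(1)
proof (induction ks)
  case (Cons k ks)
  then have "gr_invol X k (gr_invol X k (walk ks x)) = walk ks x"
    using invol_invol walk_mem[of ks x] assms(2) by simp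
  then show ?case using Cons by simp
qed simp

lemma invol_Bij: "k < gr_num X \<Longrightarrow> restrict (gr_invol X k) S \<in> Bij S"
  using bij_betw_byWitness[of S "gr_invol X k" "gr_invol X k" S] invol_mem[of k]
  by (simp add: Bij_def invol_invol image_subset_iff)

lemma gr_group_Bij: "g \<in> gr_group X \<Longrightarrow> g \<in> Bij S"
  using group.generate_in_carrier[OF group_BijGroup,
      of "(\<lambda>k. restrict (gr_invol X k) S) ` {..<gr_num X}" S g] invol_Bij
  by (auto simp: gr_group_def BijGroup_def)

text \<open>The generators are their own inverses, so words without formal inverses suffice.\<close>

lemma gr_group_imp_walk:
  assumes "g \<in> gr_group X"
  shows "\<exists>ks\<in>words. \<forall>x\<in>S. g x = walk ks x"
  using assms unfolding gr_group_def
proof (induction rule: generate.induct)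
  case one
  then show ?case by (intro bexI[of _ "[]"]) (auto simp: BijGroup_def)
next
  case (incl h)
  then obtain k where "k < gr_num X" "h = restrict (gr_invol X k) S" by auto
  then show ?case by (intro bexI[of _ "[k]"]) auto
next
  case (inv h)
  then obtain k where k: "k < gr_num X" "h = restrict (gr_invol X k) S" by auto
  have "inv_into S h x = gr_invol X k x" if "x \<in> S" for x
  proof (rule inv_into_f_eq)
    show "inj_on h S" using invol_Bij[OF k(1)] k(2) by (simp add: Bij_def bij_betw_def)
  qed (use k that in \<open>auto simp: invol_mem invol_invol\<close>)
  then have "\<forall>x\<in>S. (inv\<^bsub>BijGroup S\<^esub> h) x = walk [k] x"
    using inv_BijGroup[of h S] invol_Bij[OF k(1)] k(2) by simp
  then show ?case using k(1) by (intro bexI[of _ "[k]"]) auto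
next
  case (eng g h)
  then obtain ks ls where w: "ks \<in> words" "ls \<in> words"
    "\<forall>x\<in>S. g x = walk ks x" "\<forall>x\<in>S. h x = walk ls x" by blast
  have "g \<in> Bij S" "h \<in> Bij S" using eng.hyps gr_group_Bij by (auto simp: gr_group_def)
  then have "\<forall>x\<in>S. (g \<otimes>\<^bsub>BijGroup S\<^esub> h) x = walk (ks @ ls) x"
    using w walk_mem by (simp add: BijGroup_def compose_def)
  moreover have "ks @ ls \<in> words" using w by auto
  ultimately show ?case by blast
qed

lemma walk_imp_gr_group:
  assumes "ks \<in> words"
  shows "\<exists>g\<in>gr_group X. \<forall>x\<in>S. g x = walk ks x"
  using assms
proof (induction ks)
  case Nil
  show ?case unfolding gr_group_def
    by (rule bexI[OF _ generate.one]) (auto simp: BijGroup_def)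
next
  case (Cons k ks)
  then obtain g where g: "g \<in> gr_group X" "\<forall>x\<in>S. g x = walk ks x" by auto
  let ?k = "restrict (gr_invol X k) S"
  have k: "k < gr_num X" "?k \<in> gr_group X"
    using Cons.prems unfolding gr_group_def by (auto intro!: generate.incl)
  have "?k \<otimes>\<^bsub>BijGroup S\<^esub> g \<in> gr_group X"
    using k(2) g(1) unfolding gr_group_def by (rule generate.eng)
  moreover have "\<forall>x\<in>S. (?k \<otimes>\<^bsub>BijGroup S\<^esub> g) x = walk (k # ks) x"
    using g invol_Bij[OF k(1)] gr_group_Bij[OF g(1)] Cons.prems walk_mem[of ks]
    by (simp add: BijGroup_def compose_def)
  ultimately show ?case by blast
qed

lemma gr_orbit_eq:
  assumes "x \<in> S"
  shows "gr_orbit X x = (\<lambda>ks. walk ks x) ` words"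
proof
  show "gr_orbit X x \<subseteq> (\<lambda>ks. walk ks x) ` words"
    unfolding gr_orbit_def using gr_group_imp_walk assms by blast
  show "(\<lambda>ks. walk ks x) ` words \<subseteq> gr_orbit X x"
  proof clarify
    fix ks assume "set ks \<subseteq> {..<gr_num X}"
    then obtain g where "g \<in> gr_group X" "g x = walk ks x" using walk_imp_gr_group assms by blast
    then show "walk ks x \<in> gr_orbit X x" unfolding gr_orbit_def by (metis imageI)
  qed
qed

lemma gr_orbit_subset: "x \<in> S \<Longrightarrow> gr_orbit X x \<subseteq> S"
  using gr_orbit_eq walk_mem by auto

lemma root_in_orbit: "x \<in> S \<Longrightarrow> x \<in> gr_orbit X x"
  unfolding gr_orbit_eq by (rule image_eqI[of _ _ "[]"]) auto

lemma gr_orbit_walk: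
  assumes "x \<in> S" "ks \<in> words"
  shows "gr_orbit X (walk ks x) = gr_orbit X x"
proof
  have sub: "gr_orbit X (walk ls y) \<subseteq> gr_orbit X y" if ls: "ls \<in> words" "y \<in> S" for ls y
  proof
    fix z assume "z \<in> gr_orbit X (walk ls y)"
    then obtain ms where ms: "ms \<in> words" "z = walk ms (walk ls y)"
      using gr_orbit_eq[OF walk_mem[OF ls]] by auto
    then have "ms @ ls \<in> words" "z = walk (ms @ ls) y" using ls by auto
    then show "z \<in> gr_orbit X y" using gr_orbit_eq[OF ls(2)] by (metis imageI)
  qed
  show "gr_orbit X (walk ks x) \<subseteq> gr_orbit X x" by (rule sub[OF assms(2,1)])
  show "gr_orbit X x \<subseteq> gr_orbit X (walk ks x)"
    using sub[of "rev ks" "walk ks x"] walk_rev[OF assms(2,1)] walk_mem[OF assms(2,1)] assms(2)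
    by simp
qed

lemma orbit_graph_walk:
  assumes "x \<in> S" "ks \<in> words"
  shows "orbit_graph X (walk ks x) = orbit_graph X x"
  using gr_orbit_walk[OF assms] by (simp add: orbit_graph_def)

lemma verts_orbit_graph [simp]: "verts (orbit_graph X x) = gr_orbit X x"
  by (simp add: orbit_graph_def)

lemma edges_orbit_graph:
  assumes "x \<in> S"
  shows "(y, z) \<in> edges (orbit_graph X x) \<longleftrightarrow>
    y \<in> gr_orbit X x \<and> z \<in> gr_orbit X x \<and> y \<noteq> z \<and> (\<exists>k<gr_num X. z = gr_invol X k y)"
proof -
  have "y = gr_invol X k z \<longleftrightarrow> z = gr_invol X k y"
    if "k < gr_num X" "y \<in> gr_orbit X x" "z \<in> gr_orbit X x" for k
    using that gr_orbit_subset[OF assms] invol_invol by auto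
  then show ?thesis unfolding orbit_graph_def by auto
qed

lemma is_graph_orbit_graph:
  assumes "x \<in> S"
  shows "is_graph (orbit_graph X x)"
proof -
  have "(z, y) \<in> edges (orbit_graph X x)" if "(y, z) \<in> edges (orbit_graph X x)" for y z
  proof -
    have "(\<exists>k<gr_num X. z = gr_invol X k y)" "y \<in> gr_orbit X x" "z \<in> gr_orbit X x" "y \<noteq> z"
      using that by (auto simp: edges_orbit_graph[OF assms])
    then show ?thesis by (simp add: orbit_graph_def)
  qed
  then have "sym (edges (orbit_graph X x))" by (auto intro: symI)
  then show ?thesis by (auto simp: is_graph_def irrefl_def orbit_graph_def)
qed

lemma ball_verts_orbit_graph:
  assumes x: "x \<in> S"
  shows "ball_verts (orbit_graph X x) r x = (\<lambda>ks. walk ks x) ` {ks \<in> words. length ks \<le> r}"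
proof
  let ?E = "edges (orbit_graph X x)"
  have to: "\<exists>ks\<in>words. length ks = n \<and> y = walk ks x" if "(x, y) \<in> ?E ^^ n" for n y
    using that
  proof (induction n arbitrary: y)
    case 0
    then show ?case by (intro bexI[of _ "[]"]) auto
  next
    case (Suc n)
    then obtain z where z: "(x, z) \<in> ?E ^^ n" "(z, y) \<in> ?E" by auto
    obtain ks where ks: "ks \<in> words" "length ks = n" "z = walk ks x" using Suc.IH[OF z(1)] by blast
    obtain k where k: "k < gr_num X" "y = gr_invol X k z"
      using z(2) edges_orbit_graph[OF x] by blast
    then show ?case using ks by (intro bexI[of _ "k # ks"]) auto
  qed
  show "ball_verts (orbit_graph X x) r x \<subseteq> (\<lambda>ks. walk ks x) ` {ks \<in> words. length ks \<le> r}"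
  proof
    fix y assume "y \<in> ball_verts (orbit_graph X x) r x"
    then obtain n where "n \<le> r" "(x, y) \<in> ?E ^^ n" by (auto simp: ball_verts_def)
    then show "y \<in> (\<lambda>ks. walk ks x) ` {ks \<in> words. length ks \<le> r}" using to by blast
  qed
  \<comment> \<open>A letter that fixes the current point is no step of the orbit graph, so the distance may
    be smaller than the length of the word.\<close>
  have reach: "\<exists>n\<le>length ks. (x, walk ks x) \<in> ?E ^^ n" if "ks \<in> words" for ks
    using that
  proof (induction ks)
    case Nil
    then show ?case by auto
  next
    case (Cons k ks)
    then obtain n where n: "n \<le> length ks" "(x, walk ks x) \<in> ?E ^^ n" by auto
    show ?case
    proof (cases "walk (k # ks) x = walk ks x")
      case True
      then show ?thesis using n by (intro exI[of _ n]) auto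
    next
      case False
      have "ks \<in> words" "k < gr_num X" using Cons.prems by auto
      moreover have "walk ks x \<in> gr_orbit X x" "walk (k # ks) x \<in> gr_orbit X x"
        unfolding gr_orbit_eq[OF x] using Cons.prems \<open>ks \<in> words\<close> by blast+
      ultimately have "(walk ks x, walk (k # ks) x) \<in> ?E"
        using False edges_orbit_graph[OF x, of "walk ks x" "walk (k # ks) x"] by auto
      then show ?thesis using n by (intro exI[of _ "Suc n"]) auto
    qed
  qed
  show "(\<lambda>ks. walk ks x) ` {ks \<in> words. length ks \<le> r} \<subseteq> ball_verts (orbit_graph X x) r x"
  proof clarify
    fix ks assume ks: "set ks \<subseteq> {..<gr_num X}" "length ks \<le> r"
    then have "walk ks x \<in> gr_orbit X x" unfolding gr_orbit_eq[OF x] by auto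
    moreover obtain n where "n \<le> length ks" "(x, walk ks x) \<in> ?E ^^ n" using reach[of ks] ks by blast
    ultimately show "walk ks x \<in> ball_verts (orbit_graph X x) r x"
      unfolding ball_verts_def using ks(2) by (auto intro: exI[of _ n])
  qed
qed

section \<open>Measurability of local statistics\<close>

definition coincidences :: "nat \<Rightarrow> 'b \<Rightarrow> (nat list \<times> nat list) set" where
  "coincidences r x = {(ks, ls). ks \<in> words \<and> ls \<in> words \<and> length ks \<le> r \<and> length ls \<le> r \<and>
     walk ks x = walk ls x}"

text \<open>The vertices of the ball of radius \<open>r\<close> are named by the words of length at most \<open>r\<close>, up to
  coincidence. Deciding adjacency takes one more letter.\<close>

lemma rooted_iso_of_coincidences:
  assumes x: "x \<in> S" and y: "y \<in> S" and eq: "coincidences (Suc r) x = coincidences (Suc r) y"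
  shows "rooted_iso (rooted_ball (orbit_graph X x) r x) (rooted_ball (orbit_graph X y) r y)"
proof -
  let ?W = "{ks \<in> words. length ks \<le> r}"
  have eq': "walk ks x = walk ls x \<longleftrightarrow> walk ks y = walk ls y"
    if "ks \<in> words" "ls \<in> words" "length ks \<le> Suc r" "length ls \<le> Suc r" for ks ls
  proof -
    have "(ks, ls) \<in> coincidences (Suc r) x \<longleftrightarrow> (ks, ls) \<in> coincidences (Suc r) y" by (simp add: eq)
    then show ?thesis using that by (simp add: coincidences_def)
  qed
  define f where "f v = walk (SOME ks. ks \<in> ?W \<and> walk ks x = v) y" for v
  have f: "f (walk ks x) = walk ks y" if "ks \<in> ?W" for ks
  proof -
    let ?ls = "SOME ls. ls \<in> ?W \<and> walk ls x = walk ks x"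
    have "?ls \<in> ?W \<and> walk ?ls x = walk ks x" by (rule someI[of _ ks]) (use that in simp)
    then show ?thesis using eq'[of ?ls ks] that by (simp add: f_def)
  qed
  have V: "verts (fst (rooted_ball (orbit_graph X z) r z)) = (\<lambda>ks. walk ks z) ` ?W" if "z \<in> S" for z
    using ball_verts_orbit_graph[OF that] by simp
  have E: "(walk ks z, walk ls z) \<in> edges (fst (rooted_ball (orbit_graph X z) r z)) \<longleftrightarrow>
      walk ks z \<noteq> walk ls z \<and> (\<exists>k<gr_num X. walk ls z = walk (k # ks) z)"
    if "z \<in> S" "ks \<in> ?W" "ls \<in> ?W" for z ks ls
  proof -
    have "walk ks z \<in> ball_verts (orbit_graph X z) r z" "walk ls z \<in> ball_verts (orbit_graph X z) r z"
      using that(2,3) ball_verts_orbit_graph[OF that(1)] by blast+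
    then show ?thesis
      using edges_orbit_graph[OF that(1)] ball_verts_subset[of "orbit_graph X z" r z] by auto
  qed
  have "bij_betw f (verts (fst (rooted_ball (orbit_graph X x) r x)))
      (verts (fst (rooted_ball (orbit_graph X y) r y)))"
    unfolding V[OF x] V[OF y] bij_betw_def
  proof
    show "inj_on f ((\<lambda>ks. walk ks x) ` ?W)"
      using f eq' by (auto simp: inj_on_def)
    show "f ` (\<lambda>ks. walk ks x) ` ?W = (\<lambda>ks. walk ks y) ` ?W"
      unfolding image_image using f by (intro image_cong) auto
  qed
  moreover have "f x = y" using f[of "[]"] by simp
  moreover have "(walk ks x, walk ls x) \<in> edges (fst (rooted_ball (orbit_graph X x) r x)) \<longleftrightarrow>
      (f (walk ks x), f (walk ls x)) \<in> edges (fst (rooted_ball (orbit_graph X y) r y))"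
    if w: "ks \<in> ?W" "ls \<in> ?W" for ks ls
  proof -
    have "walk ls x = walk (k # ks) x \<longleftrightarrow> walk ls y = walk (k # ks) y" if "k < gr_num X" for k
      using eq'[of ls "k # ks"] w that by auto
    moreover have "walk ks x = walk ls x \<longleftrightarrow> walk ks y = walk ls y" using eq'[of ks ls] w by auto
    ultimately show ?thesis unfolding f[OF w(1)] f[OF w(2)] E[OF x w] E[OF y w] by auto
  qed
  ultimately show ?thesis
    unfolding rooted_iso_def by (intro exI[of _ f]) (auto simp only: V[OF x] rooted_ball_simps(3))
qed

lemma continuous_on_walk: "ks \<in> words \<Longrightarrow> continuous_on S (\<lambda>x. walk ks x)"
proof (induction ks)
  case (Cons k ks)
  have "continuous_on S (\<lambda>x. gr_invol X k (walk ks x))"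
    by (rule continuous_on_compose2[OF continuous_on_invol, of k]) (use Cons walk_mem in auto)
  then show ?case by simp
qed auto

lemma walk_eq_measurable:
  assumes "ks \<in> words" "ls \<in> words"
  shows "{x \<in> S. walk ks x = walk ls x} \<in> sets M"
proof -
  have "continuous_on S (\<lambda>x. dist (walk ks x) (walk ls x))"
    using assms by (intro continuous_on_dist continuous_on_walk)
  then have "(\<lambda>x. dist (walk ks x) (walk ls x)) \<in> borel_measurable M"
    using borel_measurable_continuous_on_restrict measurable_cong_sets[OF sets_M refl] by blast
  then have "{x \<in> space M. dist (walk ks x) (walk ls x) = 0} \<in> sets M" by measurable
  then show ?thesis by (simp add: space_M)
qed

lemma finite_short_words: "finite {ks \<in> words. length ks \<le> r}"
  using finite_lists_length_le[of "{..<gr_num X}" r] by simp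

text \<open>Words act continuously, so a single coincidence holds on a closed subset of \<open>S\<close>.\<close>

lemma coincidences_measurable: "{x \<in> S. coincidences r x = p} \<in> sets M"
proof -
  let ?W = "{ks \<in> words. length ks \<le> r}"
  have "{x \<in> S. coincidences r x = p} = {x \<in> space M. p \<subseteq> ?W \<times> ?W \<and>
      (\<forall>ks\<in>?W. \<forall>ls\<in>?W. (ks, ls) \<in> p \<longleftrightarrow> walk ks x = walk ls x)}"
    unfolding coincidences_def space_M by auto
  also have "\<dots> \<in> sets M"
  proof -
    have "{x \<in> space M. (ks, ls) \<in> p \<longleftrightarrow> walk ks x = walk ls x} \<in> sets M"
      if "ks \<in> words" "ls \<in> words" for ks ls
    proof (cases "(ks, ls) \<in> p")
      case True
      then show ?thesis using walk_eq_measurable[OF that] by (simp add: space_M)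
    next
      case False
      then show ?thesis using sets.sets_Collect_neg[of M "\<lambda>x. walk ks x = walk ls x"]
        walk_eq_measurable[OF that] by (simp add: space_M)
    qed
    then show ?thesis
      by (intro sets.sets_Collect_conj sets.sets_Collect_const sets.sets_Collect_finite_All
          finite_short_words) auto
  qed
  finally show ?thesis .
qed

text \<open>There are finitely many short words, hence finitely many patterns of coincidences, and \<open>P\<close> is
  a union of level sets.\<close>

lemma local_property_measurable:
  assumes "\<And>x y. x \<in> S \<Longrightarrow> y \<in> S \<Longrightarrow> coincidences r x = coincidences r y \<Longrightarrow> P x \<Longrightarrow> P y"
  shows "{x \<in> S. P x} \<in> sets M"
proof -
  let ?W = "{ks \<in> words. length ks \<le> r}" and ?C = "coincidences r ` {x \<in> S. P x}"
  have "finite ?C"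
    by (rule finite_subset[of _ "Pow (?W \<times> ?W)"])
      (auto simp: coincidences_def simp del: mem_Collect_eq intro!: finite_short_words)
  then have "(\<Union>p\<in>?C. {x \<in> S. coincidences r x = p}) \<in> sets M"
    by (intro sets.finite_UN coincidences_measurable)
  moreover have "{x \<in> S. P x} = (\<Union>p\<in>?C. {x \<in> S. coincidences r x = p})"
    using assms by auto
  ultimately show ?thesis by simp
qed

lemma rooted_iso_measurable:
  assumes "is_graph (fst \<alpha>)"
  shows "{x \<in> S. rooted_iso (rooted_ball (orbit_graph X x) r x) \<alpha>} \<in> sets M"
proof (rule local_property_measurable[of "Suc r"])
  fix x y assume x: "x \<in> S" and y: "y \<in> S" and eq: "coincidences (Suc r) x = coincidences (Suc r) y"
    and iso: "rooted_iso (rooted_ball (orbit_graph X x) r x) \<alpha>"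
  have "rooted_iso (rooted_ball (orbit_graph X y) r y) (rooted_ball (orbit_graph X x) r x)"
    by (rule rooted_iso_of_coincidences[OF y x eq[symmetric]])
  then show "rooted_iso (rooted_ball (orbit_graph X y) r y) \<alpha>"
    by (rule rooted_iso_trans[OF is_graph_rooted_ball[OF is_graph_orbit_graph[OF y]]
          is_graph_rooted_ball[OF is_graph_orbit_graph[OF x]] assms _ iso])
qed

text \<open>The formula by classes holds almost everywhere only, and the measure need not be complete, so
  measurability is obtained from locality. The pattern for length \<open>j + 1\<close> determines the ball of
  radius \<open>j\<close>.\<close>

lemma num_reduced_measurable:
  "(\<lambda>x. real (num_reduced (orbit_graph X x) j x)) \<in> borel_measurable M"
proof -
  have "{x \<in> S. num_reduced (orbit_graph X x) j x = n} \<in> sets M" for n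
  proof (rule local_property_measurable[of "Suc j"])
    fix x y assume x: "x \<in> S" and y: "y \<in> S" and eq: "coincidences (Suc j) x = coincidences (Suc j) y"
      and n: "num_reduced (orbit_graph X x) j x = n"
    note G = is_graph_orbit_graph[OF x] is_graph_orbit_graph[OF y]
    have V: "x \<in> verts (orbit_graph X x)" "y \<in> verts (orbit_graph X y)"
      using root_in_orbit x y by auto
    show "num_reduced (orbit_graph X y) j y = n"
      using num_reduced_iso[OF is_graph_rooted_ball[OF G(1)] is_graph_rooted_ball[OF G(2)] _
          rooted_iso_of_coincidences[OF x y eq], of j] root_in_ball[OF V(1), of j] n
        num_reduced_rooted_ball[OF G(1) V(1) order.refl] num_reduced_rooted_ball[OF G(2) V(2) order.refl]
      by simp
  qed
  then have "(\<lambda>x. num_reduced (orbit_graph X x) j x) \<in> measurable M (count_space UNIV)"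
    unfolding measurable_count_space_eq2_countable space_M vimage_def Int_def by (simp add: conj_commute)
  then show ?thesis by measurable
qed

section \<open>Limit graphings\<close>

text \<open>A point whose ball of radius \<open>1\<close> lies in one of these classes has at most \<open>D\<close> neighbours, and
  almost every point is of this kind. Invariance of the measure carries this over to the points
  \<open>walk ks x\<close>, one word \<open>ks\<close> at a time, and there are only countably many words.\<close>

lemma AE_degree_bounded:
  assumes "(\<Sum>\<alpha>\<in>class_reps D 1.
    measure M {x \<in> S. rooted_iso (rooted_ball (orbit_graph X x) 1 x) \<alpha>}) = 1"
  shows "AE x in M. degree_bounded D (orbit_graph X x)"
proof -
  let ?A = "\<lambda>\<alpha>. {x \<in> S. rooted_iso (rooted_ball (orbit_graph X x) 1 x) \<alpha>}"
  let ?P = "\<lambda>x. card (edges (orbit_graph X x) `` {x}) \<le> D"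
  have rep: "is_graph (fst \<alpha>)" if "\<alpha> \<in> class_reps D 1" for \<alpha>
    by (rule rooted_graphsD(1)[OF class_repsD(1)[OF that]])
  have meas: "?A \<alpha> \<in> sets M" if "\<alpha> \<in> class_reps D 1" for \<alpha>
    by (rule rooted_iso_measurable[OF rep[OF that]])
  \<comment> \<open>A ball is isomorphic to at most one representative, so the frequencies add up.\<close>
  have "disjoint_family_on ?A (class_reps D 1)"
    unfolding disjoint_family_on_def
  proof (intro ballI impI)
    fix \<alpha> \<beta> assume \<alpha>: "\<alpha> \<in> class_reps D 1" and \<beta>: "\<beta> \<in> class_reps D 1" and "\<alpha> \<noteq> \<beta>"
    have "\<not> (rooted_iso (rooted_ball (orbit_graph X x) 1 x) \<alpha> \<and>
        rooted_iso (rooted_ball (orbit_graph X x) 1 x) \<beta>)" if x: "x \<in> S" for x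
    proof
      let ?B = "rooted_ball (orbit_graph X x) 1 x"
      assume iso: "rooted_iso ?B \<alpha> \<and> rooted_iso ?B \<beta>"
      have B: "is_graph (fst ?B)" "snd ?B \<in> verts (fst ?B)"
        using is_graph_rooted_ball[OF is_graph_orbit_graph[OF x]]
          root_in_ball[of x "orbit_graph X x" 1] root_in_orbit[OF x] by auto
      have "rooted_iso \<alpha> \<beta>"
        using rooted_iso_trans[OF rep[OF \<alpha>] B(1) rep[OF \<beta>] rooted_iso_sym[OF B(1) rep[OF \<alpha>] B(2)]]
          iso by blast
      moreover obtain \<gamma> where "\<And>\<delta>. \<delta> \<in> class_reps D 1 \<Longrightarrow> rooted_iso \<alpha> \<delta> \<longleftrightarrow> \<delta> = \<gamma>"
        using class_reps_cover class_repsD[OF \<alpha>] by blast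
      ultimately show False using \<alpha> \<beta> \<open>\<alpha> \<noteq> \<beta>\<close> rooted_iso_refl[of \<alpha>] by auto
    qed
    then show "?A \<alpha> \<inter> ?A \<beta> = {}" by blast
  qed
  then have "prob (\<Union>\<alpha>\<in>class_reps D 1. ?A \<alpha>) = 1"
    using finite_measure_finite_Union[OF finite_class_reps, of ?A D 1] meas assms by fastforce
  moreover have "(\<Union>\<alpha>\<in>class_reps D 1. ?A \<alpha>) \<in> sets M"
    using meas by (intro sets.finite_UN finite_class_reps)
  ultimately have "AE x in M. x \<in> (\<Union>\<alpha>\<in>class_reps D 1. ?A \<alpha>)"
    using prob_eq_1 by blast
  then have P: "AE x in M. ?P x"
  proof (rule AE_mp, intro AE_I2 impI)
    fix x assume "x \<in> (\<Union>\<alpha>\<in>class_reps D 1. ?A \<alpha>)"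
    then obtain \<alpha> where \<alpha>: "\<alpha> \<in> class_reps D 1" "x \<in> S"
      "rooted_iso (rooted_ball (orbit_graph X x) 1 x) \<alpha>" by auto
    then show "?P x"
      using card_neighbours_le_of_class[OF is_graph_orbit_graph[OF \<alpha>(2)] _ class_repsD(1)[OF \<alpha>(1)] \<alpha>(3)]
        root_in_orbit by simp
  qed
  have invol: "gr_invol X k \<in> measurable M M" if "k < gr_num X" for k
  proof -
    have "gr_invol X k \<in> measurable (restrict_space borel S) (restrict_space borel S)"
      using borel_measurable_continuous_on_restrict[OF continuous_on_invol[OF that]] invol_mem[OF that]
      by (intro measurable_restrict_space2) (auto simp: space_restrict_space)
    then show ?thesis using measurable_cong_sets[OF sets_M sets_M] by blast
  qed
  have "AE x in M. ?P (walk ks x)" if "ks \<in> words" for ks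
  proof -
    \<comment> \<open>The first letter of a word acts last, so it is absorbed into the property.\<close>
    have "AE x in M. Q (walk ks x)" if "AE x in M. Q x" for Q
      using \<open>ks \<in> words\<close> that
    proof (induction ks arbitrary: Q)
      case (Cons k ks)
      then have k: "k < gr_num X" by auto
      have "AE x in distr M M (gr_invol X k). Q x" unfolding distr_invol[OF k] by (rule Cons.prems(2))
      then have "AE x in M. Q (gr_invol X k x)" by (rule AE_distrD[OF invol[OF k]])
      then show ?case using Cons.IH[of "\<lambda>x. Q (gr_invol X k x)"] Cons.prems by simp
    qed simp
    then show ?thesis using P by blast
  qed
  then have "AE x in M. \<forall>ks. ks \<in> words \<longrightarrow> ?P (walk ks x)"
    unfolding AE_all_countable by auto
  then show ?thesis
  proof (rule AE_mp, intro AE_I2 impI)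
    fix x assume "x \<in> space M" and all: "\<forall>ks. ks \<in> words \<longrightarrow> ?P (walk ks x)"
    then have x: "x \<in> S" by (simp add: space_M)
    show "degree_bounded D (orbit_graph X x)"
      unfolding degree_bounded_def
    proof
      fix y assume "y \<in> verts (orbit_graph X x)"
      then obtain ks where ks: "ks \<in> words" "y = walk ks x" using gr_orbit_eq[OF x] by auto
      have "edges (orbit_graph X x) `` {y} \<subseteq> (\<lambda>k. gr_invol X k y) ` {..<gr_num X}"
        using edges_orbit_graph[OF x] by auto
      then have "finite (edges (orbit_graph X x) `` {y})" by (rule finite_subset) simp
      moreover have "card (edges (orbit_graph X x) `` {y}) \<le> D"
        using all ks orbit_graph_walk[OF x ks(1)] by auto
      ultimately show "finite (edges (orbit_graph X x) `` {y}) \<and>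
        card (edges (orbit_graph X x) `` {y}) \<le> D" by simp
    qed
  qed
qed

lemma integral_num_reduced_eq_measure_classes:
  assumes "AE x in M. degree_bounded D (orbit_graph X x)"
  shows "(\<integral>x. real (num_reduced (orbit_graph X x) j x) \<partial>M) =
    (\<Sum>s<j. \<Sum>\<alpha>\<in>class_reps D (Suc s).
       path_gain j s \<alpha> * measure M {x \<in> S. rooted_iso (rooted_ball (orbit_graph X x) (Suc s) x) \<alpha>})"
proof -
  let ?A = "\<lambda>s \<alpha>. {x \<in> S. rooted_iso (rooted_ball (orbit_graph X x) (Suc s) x) \<alpha>}"
  have [measurable]: "?A s \<alpha> \<in> sets M" if "\<alpha> \<in> class_reps D (Suc s)" for s \<alpha>
    by (rule rooted_iso_measurable[OF rooted_graphsD(1)[OF class_repsD(1)[OF that]]])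
  have int: "integrable M (\<lambda>x. path_gain j s \<alpha> * indicator (?A s \<alpha>) x)"
    if "\<alpha> \<in> class_reps D (Suc s)" for s \<alpha>
    using that by (intro integrable_mult_right integrable_real_indicator) (auto simp: emeasure_finite less_top[symmetric])
  have "(\<integral>x. real (num_reduced (orbit_graph X x) j x) \<partial>M) =
      (\<integral>x. (\<Sum>s<j. \<Sum>\<alpha>\<in>class_reps D (Suc s). path_gain j s \<alpha> * indicator (?A s \<alpha>) x) \<partial>M)"
  proof (rule integral_cong_AE)
    show "(\<lambda>x. real (num_reduced (orbit_graph X x) j x)) \<in> borel_measurable M"
      by (rule num_reduced_measurable)
    show "(\<lambda>x. \<Sum>s<j. \<Sum>\<alpha>\<in>class_reps D (Suc s). path_gain j s \<alpha> * indicator (?A s \<alpha>) x) \<in> borel_measurable M"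
      using int by (intro borel_measurable_sum) (rule borel_measurable_integrable)
    show "AE x in M. real (num_reduced (orbit_graph X x) j x) =
        (\<Sum>s<j. \<Sum>\<alpha>\<in>class_reps D (Suc s). path_gain j s \<alpha> * indicator (?A s \<alpha>) x)"
      using assms
    proof (rule AE_mp, intro AE_I2 impI)
      fix x assume "x \<in> space M" and deg: "degree_bounded D (orbit_graph X x)"
      then have x: "x \<in> S" by (simp add: space_M)
      show "real (num_reduced (orbit_graph X x) j x) =
          (\<Sum>s<j. \<Sum>\<alpha>\<in>class_reps D (Suc s). path_gain j s \<alpha> * indicator (?A s \<alpha>) x)"
        using num_reduced_eq_sum_classes[OF is_graph_orbit_graph[OF x] deg, of x j] root_in_orbit[OF x] x
        by (simp add: indicator_def)
    qed
  qed
  also have "\<dots> = (\<Sum>s<j. \<Sum>\<alpha>\<in>class_reps D (Suc s). path_gain j s \<alpha> * measure M (?A s \<alpha>))"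
    using int by (simp add: Bochner_Integration.integral_sum Bochner_Integration.integrable_sum)
  finally show ?thesis .
qed

end

section \<open>Exponentials of power series\<close>

text \<open>The power \<open>u ^ j\<close> and its coefficient have index \<open>i = j - 1\<close>.\<close>

definition zeta_term :: "(nat \<Rightarrow> real) \<Rightarrow> complex \<Rightarrow> nat \<Rightarrow> complex" where
  "zeta_term a u i = 1 / of_nat (Suc i) * of_real (a i) * u ^ Suc i"

lemma norm_zeta_term_le:
  assumes "norm u \<le> r"
  shows "norm (zeta_term a u i) \<le> \<bar>a i\<bar> * r ^ Suc i"
proof -
  have "norm (zeta_term a u i) = (\<bar>a i\<bar> * norm u ^ Suc i) / real (Suc i)"
    by (simp add: zeta_term_def norm_mult norm_divide norm_power del: of_nat_Suc power_Suc)
  also have "\<dots> \<le> \<bar>a i\<bar> * norm u ^ Suc i"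
    using divide_left_mono[of 1 "real (Suc i)" "\<bar>a i\<bar> * norm u ^ Suc i"] by simp
  also have "\<dots> \<le> \<bar>a i\<bar> * r ^ Suc i"
    using assms by (intro mult_left_mono power_mono) auto
  finally show ?thesis .
qed

lemma summable_majorant:
  fixes C q r :: real
  assumes "0 \<le> q" "0 \<le> r" "q * r < 1"
  shows "summable (\<lambda>i. C * q ^ i * r ^ Suc i)"
proof -
  have "summable (\<lambda>i. C * r * (q * r) ^ i)"
    using assms by (intro summable_mult summable_geometric) simp
  then show ?thesis by (simp add: power_mult_distrib mult_ac)
qed

lemma zeta_term_majorant:
  assumes "norm u \<le> r" "\<bar>a i\<bar> \<le> C * q ^ i"
  shows "norm (zeta_term a u i) \<le> C * q ^ i * r ^ Suc i"
proof -
  have "0 \<le> r" using assms(1) norm_ge_zero order.trans by blast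
  then have "\<bar>a i\<bar> * r ^ Suc i \<le> C * q ^ i * r ^ Suc i"
    using assms(2) by (intro mult_right_mono) auto
  then show ?thesis using norm_zeta_term_le[OF assms(1), of a i] by linarith
qed

lemma summable_zeta_term:
  assumes "0 \<le> q" "q * r < 1" "norm u \<le> r" "\<And>i. \<bar>a i\<bar> \<le> C * q ^ i"
  shows "summable (zeta_term a u)"
proof (rule summable_comparison_test')
  have "0 \<le> r" using assms(3) norm_ge_zero order.trans by blast
  then show "summable (\<lambda>i. C * q ^ i * r ^ Suc i)" using summable_majorant assms by blast
qed (rule zeta_term_majorant[OF assms(3,4)])

text \<open>On the disc of radius \<open>r\<close> the two series differ by at most
  \<open>(\<Sum>i. \<bar>a n i - b i\<bar> * r ^ Suc i)\<close>, which tends to \<open>0\<close> by dominated convergence.\<close>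

lemma uniform_limit_exp_zeta_series:
  fixes a :: "nat \<Rightarrow> nat \<Rightarrow> real"
  assumes "0 \<le> q" "0 \<le> r" "q * r < 1"
    and a: "\<And>n i. \<bar>a n i\<bar> \<le> C * q ^ i" and b: "\<And>i. \<bar>b i\<bar> \<le> C * q ^ i"
    and lim: "\<And>i. (\<lambda>n. a n i) \<longlonglongrightarrow> b i"
  shows "uniform_limit (cball 0 r) (\<lambda>n u. exp (\<Sum>i. zeta_term (a n) u i))
    (\<lambda>u. exp (\<Sum>i. zeta_term b u i)) sequentially"
proof -
  let ?M = "\<lambda>i. C * q ^ i * r ^ Suc i"
  let ?d = "\<lambda>i n. \<bar>a n i - b i\<bar> * r ^ Suc i"
  have M: "summable ?M" by (rule summable_majorant[OF assms(1-3)])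
  have M2: "summable (\<lambda>i. 2 * ?M i)" using M by (rule summable_mult)
  have d_le: "norm (?d i n) \<le> 2 * ?M i" for i n
  proof -
    have "\<bar>a n i - b i\<bar> \<le> 2 * (C * q ^ i)" using a[of n i] b[of i] by linarith
    then have "?d i n \<le> 2 * (C * q ^ i) * r ^ Suc i"
      using assms(2) by (intro mult_right_mono) auto
    then show ?thesis using assms(2) by (simp add: abs_mult mult_ac)
  qed
  have "(\<lambda>n. ?d i n) \<longlonglongrightarrow> 0" for i
  proof -
    have "(\<lambda>n. a n i - b i) \<longlonglongrightarrow> 0" using lim[of i] by (simp add: LIM_zero)
    then have "(\<lambda>n. \<bar>a n i - b i\<bar>) \<longlonglongrightarrow> 0" by (rule tendsto_rabs_zero)
    then show ?thesis by (rule tendsto_mult_left_zero)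
  qed
  moreover have "\<forall>\<^sub>F (i, n) in sequentially \<times>\<^sub>F sequentially. norm (?d i n) \<le> 2 * ?M i"
    using d_le by (intro always_eventually) auto
  ultimately have "(\<lambda>n. \<Sum>i. ?d i n) \<longlonglongrightarrow> (\<Sum>i. 0)"
    using tannerys_theorem[of ?d "\<lambda>_. 0", OF _ _ M2 sequentially_bot] by blast
  then have d_lim: "(\<lambda>n. \<Sum>i. ?d i n) \<longlonglongrightarrow> 0" by simp
  have d_sum: "summable (\<lambda>i. ?d i n)" for n
    by (rule summable_comparison_test'[OF M2]) (rule d_le)
  have sa: "summable (zeta_term (a n) u)" if "u \<in> cball 0 r" for n u
    by (rule summable_zeta_term[OF assms(1,3) _ a]) (use that in simp)
  have sb: "summable (zeta_term b u)" if "u \<in> cball 0 r" for u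
    by (rule summable_zeta_term[OF assms(1,3) _ b]) (use that in simp)
  have diff: "norm ((\<Sum>i. zeta_term (a n) u i) - (\<Sum>i. zeta_term b u i)) \<le> (\<Sum>i. ?d i n)"
    if u: "u \<in> cball 0 r" for n u
  proof -
    have "(\<Sum>i. zeta_term (a n) u i) - (\<Sum>i. zeta_term b u i) =
        (\<Sum>i. zeta_term (\<lambda>i. a n i - b i) u i)"
      unfolding suminf_diff[OF sa[OF u] sb[OF u]]
      by (simp add: zeta_term_def ring_distribs)
    moreover have "norm (zeta_term (\<lambda>i. a n i - b i) u i) \<le> ?d i n" for i
      using u by (intro norm_zeta_term_le) (simp add: dist_norm)
    ultimately show ?thesis by (simp only: norm_suminf_le[OF _ d_sum])
  qed
  have S: "uniform_limit (cball 0 r) (\<lambda>n u. \<Sum>i. zeta_term (a n) u i)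
      (\<lambda>u. \<Sum>i. zeta_term b u i) sequentially"
  proof (rule uniform_limitI)
    fix e :: real assume "0 < e"
    then have "\<forall>\<^sub>F n in sequentially. (\<Sum>i. ?d i n) < e"
      using order_tendstoD(2)[OF d_lim] by blast
    then show "\<forall>\<^sub>F n in sequentially. \<forall>u\<in>cball 0 r.
        dist (\<Sum>i. zeta_term (a n) u i) (\<Sum>i. zeta_term b u i) < e"
    proof eventually_elim
      case (elim n)
      then show ?case using diff[of _ n] unfolding dist_norm by (meson le_less_trans)
    qed
  qed
  have bounded: "(\<Sum>i. zeta_term c u i) \<in> cball 0 (\<Sum>i. ?M i)"
    if "u \<in> cball 0 r" "\<And>i. \<bar>c i\<bar> \<le> C * q ^ i" for c u
    using norm_suminf_le[OF zeta_term_majorant[of u r c] M] that by (simp add: dist_norm)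
  \<comment> \<open>All values of the series lie in one compact disc, on which \<open>exp\<close> is uniformly continuous.\<close>
  have "uniformly_continuous_on (cball 0 (\<Sum>i. ?M i)) (exp :: complex \<Rightarrow> complex)"
    by (intro compact_uniformly_continuous continuous_intros) auto
  from uniform_limit_compose[OF S this] show ?thesis
    using bounded a b by (simp add: image_subset_iff o_def)
qed

lemma holomorphic_zeta_series:
  assumes "open U" "0 \<le> q" "\<And>K. compact K \<Longrightarrow> K \<subseteq> U \<Longrightarrow> \<exists>r. q * r < 1 \<and> K \<subseteq> cball 0 r"
    and b: "\<And>i. \<bar>b i\<bar> \<le> C * q ^ i"
  shows "(\<lambda>u. \<Sum>i. zeta_term b u i) holomorphic_on U"
proof (rule holomorphic_uniform_sequence[OF assms(1)])
  show "(\<lambda>u. \<Sum>i<n. zeta_term b u i) holomorphic_on U" for n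
    unfolding zeta_term_def by (intro holomorphic_intros) auto
  fix x assume "x \<in> U"
  then obtain d where d: "d > 0" "cball x d \<subseteq> U" using assms(1) open_contains_cball[of U] by auto
  obtain r where r: "q * r < 1" "cball x d \<subseteq> cball 0 r" using assms(3)[OF compact_cball d(2)] by auto
  have r_bound: "norm u \<le> r" if "u \<in> cball x d" for u using r(2) that by auto
  have "norm x \<le> r" using r_bound[of x] d(1) by simp
  then have "0 \<le> r" using norm_ge_zero[of x] by linarith
  have "uniform_limit (cball x d) (\<lambda>n u. \<Sum>i<n. zeta_term b u i) (\<lambda>u. \<Sum>i. zeta_term b u i) sequentially"
  proof (rule Weierstrass_m_test)
    show "norm (zeta_term b u i) \<le> C * q ^ i * r ^ Suc i" if "u \<in> cball x d" for i u
      by (rule zeta_term_majorant[OF r_bound[OF that] b])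
    show "summable (\<lambda>i. C * q ^ i * r ^ Suc i)"
      by (rule summable_majorant[OF assms(2) \<open>0 \<le> r\<close> r(1)])
  qed
  then show "\<exists>d>0. cball x d \<subseteq> U \<and> uniform_limit (cball x d)
      (\<lambda>n u. \<Sum>i<n. zeta_term b u i) (\<lambda>u. \<Sum>i. zeta_term b u i) sequentially"
    using d by blast
qed

lemma open_zeta_disc: "open (zeta_disc D)"
  by (simp add: zeta_disc_def)

text \<open>Multiplying by \<open>D - 1\<close> instead of dividing makes the case \<open>D = 1\<close>, where the disc is the
  whole plane, uniform with the others.\<close>

lemma compact_subset_zeta_disc:
  assumes "D \<ge> 1" "compact K" "K \<subseteq> zeta_disc D"
  shows "\<exists>r\<ge>0. real (D - 1) * r < 1 \<and> K \<subseteq> cball 0 r"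
proof (cases "K = {}")
  case True
  then show ?thesis by (intro exI[of _ 0]) auto
next
  case False
  then obtain u where u: "u \<in> K" "\<And>v. v \<in> K \<Longrightarrow> norm v \<le> norm u"
    using continuous_attains_sup[OF assms(2), of norm] continuous_on_norm_id by blast
  have "real (D - 1) * norm u < 1"
  proof (cases "D = 1")
    case False
    then have "norm u < inverse (real D - 1)" using u(1) assms(3) by (auto simp: zeta_disc_def)
    then show ?thesis using False assms(1) by (simp add: of_nat_diff field_simps)
  qed simp
  then show ?thesis using u(2) by (intro exI[of _ "norm u"]) (auto simp: dist_norm)
qed

section \<open>The limit of the normalized Zeta functions\<close>

definition mean_paths :: "'a graph \<Rightarrow> nat \<Rightarrow> real" where
  "mean_paths G i = 1 / real (card (verts G)) * (\<Sum>x\<in>verts G. real (num_reduced G (Suc i) x))"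

lemma zeta_norm_eq: "zeta_norm G u = exp (\<Sum>i. zeta_term (mean_paths G) u i)"
  by (simp add: zeta_norm_def zeta_term_def mean_paths_def)

lemma mean_paths_le:
  assumes "is_graph G" "degree_bounded D G" "finite (verts G)"
  shows "\<bar>mean_paths G i\<bar> \<le> real D * real (D - 1) ^ i"
proof -
  have "(\<Sum>x\<in>verts G. real (num_reduced G (Suc i) x)) \<le> (\<Sum>x\<in>verts G. real (D * (D - 1) ^ i))"
    using num_reduced_le[OF assms(1,2)] by (intro sum_mono) (simp only: of_nat_le_iff)
  then have le: "(\<Sum>x\<in>verts G. real (num_reduced G (Suc i) x)) \<le>
      real (card (verts G)) * (real D * real (D - 1) ^ i)" by simp
  have "mean_paths G i \<ge> 0" by (simp add: mean_paths_def sum_nonneg)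
  moreover have "mean_paths G i \<le> real D * real (D - 1) ^ i"
  proof (cases "card (verts G) = 0")
    case True
    then show ?thesis by (simp add: mean_paths_def)
  next
    case False
    then show ?thesis using le by (simp add: mean_paths_def divide_le_eq mult_ac)
  qed
  ultimately show ?thesis by simp
qed

theorem theorem5p9:
  fixes G :: "nat \<Rightarrow> 'a graph" and D :: nat
  assumes "D \<ge> 1"
    and "\<And>n. is_graph (G n)"
    and "\<And>n. finite (verts (G n))"
    and "\<And>n. graph_connected (G n)"
    and "\<And>n. degree_bounded D (G n)"
    and "weakly_convergent D G"
  shows "\<exists>Z. Z holomorphic_on zeta_disc D \<and>
           (\<forall>K. compact K \<and> K \<subseteq> zeta_disc D \<longrightarrow>
              uniform_limit K (\<lambda>n. zeta_norm (G n)) Z sequentially) \<and>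
           (\<forall>\<X> :: ('b :: metric_space) graphing.
              limit_graphing D G \<X> \<and>
              ((\<forall>\<^sub>F n in sequentially. card (verts (G n)) = 1) \<longrightarrow>
                 (AE x in gr_measure \<X>. degree_bounded D (orbit_graph \<X> x))) \<longrightarrow>
              (\<forall>u\<in>zeta_disc D. Z u = zeta_graphing \<X> u))"
proof -
  define p where "p \<alpha> = lim (\<lambda>n. ball_freq (G n) \<alpha>)" for \<alpha>
  have p: "(\<lambda>n. ball_freq (G n) \<alpha>) \<longlonglongrightarrow> p \<alpha>" if "\<alpha> \<in> class_reps D s" for s \<alpha>
    using assms(6) class_repsD(1)[OF that] unfolding weakly_convergent_def p_def
    by (simp add: convergent_LIMSEQ_iff)
  define b where "b i = (\<Sum>s<Suc i. \<Sum>\<alpha>\<in>class_reps D (Suc s). path_gain (Suc i) s \<alpha> * p \<alpha>)" for i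
  have mean: "mean_paths (G n) i =
      (\<Sum>s<Suc i. \<Sum>\<alpha>\<in>class_reps D (Suc s). path_gain (Suc i) s \<alpha> * ball_freq (G n) \<alpha>)" for n i
    unfolding mean_paths_def by (rule mean_num_reduced_eq_ball_freq[OF assms(2,5,3)])
  have lim: "(\<lambda>n. mean_paths (G n) i) \<longlonglongrightarrow> b i" for i
    unfolding mean b_def by (intro tendsto_sum tendsto_mult tendsto_const p)
  have a_le: "\<bar>mean_paths (G n) i\<bar> \<le> real D * real (D - 1) ^ i" for n i
    by (rule mean_paths_le[OF assms(2,5,3)])
  have b_le: "\<bar>b i\<bar> \<le> real D * real (D - 1) ^ i" for i
    using tendsto_upperbound[OF tendsto_rabs[OF lim]] a_le by simp
  define Z where "Z u = exp (\<Sum>i. zeta_term b u i)" for u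
  have "Z holomorphic_on zeta_disc D"
    unfolding Z_def
    using holomorphic_zeta_series[OF open_zeta_disc _ _ b_le] compact_subset_zeta_disc[OF assms(1)]
    by (intro holomorphic_on_exp') (metis of_nat_0_le_iff)
  moreover have "uniform_limit K (\<lambda>n. zeta_norm (G n)) Z sequentially"
    if K: "compact K" "K \<subseteq> zeta_disc D" for K
  proof -
    obtain r where r: "0 \<le> r" "real (D - 1) * r < 1" "K \<subseteq> cball 0 r"
      using compact_subset_zeta_disc[OF assms(1) K] by blast
    have "uniform_limit (cball 0 r) (\<lambda>n u. zeta_norm (G n) u) Z sequentially"
      unfolding zeta_norm_eq Z_def
      by (rule uniform_limit_exp_zeta_series[OF _ r(1,2) a_le b_le lim]) simp
    then show ?thesis using r(3) by (rule uniform_limit_on_subset)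
  qed
  moreover have "Z u = zeta_graphing \<X> u"
    if limit: "limit_graphing D G \<X>"
      and single: "(\<forall>\<^sub>F n in sequentially. card (verts (G n)) = 1) \<longrightarrow>
        (AE x in gr_measure \<X>. degree_bounded D (orbit_graph \<X> x))"
    for \<X> :: "'b graphing" and u
  proof -
    interpret graphing \<X> by unfold_locales (use limit in \<open>simp add: limit_graphing_def\<close>)
    let ?\<mu> = "\<lambda>s \<alpha>. measure M {x \<in> S. rooted_iso (rooted_ball (orbit_graph \<X> x) s x) \<alpha>}"
    have \<mu>: "(\<lambda>n. ball_freq (G n) \<alpha>) \<longlonglongrightarrow> ?\<mu> s \<alpha>" if "\<alpha> \<in> class_reps D s" for s \<alpha>
      using limit class_repsD[OF that] unfolding limit_graphing_def by auto
    have \<mu>_eq: "?\<mu> s \<alpha> = p \<alpha>" if "\<alpha> \<in> class_reps D s" for s \<alpha>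
      by (rule LIMSEQ_unique[OF \<mu>[OF that] p[OF that]])
    have deg: "AE x in M. degree_bounded D (orbit_graph \<X> x)"
    proof (cases "\<forall>\<^sub>F n in sequentially. card (verts (G n)) = 1")
      case False
      \<comment> \<open>For infinitely many \<open>n\<close> the frequencies add up to \<open>1\<close>, hence so do their limits.\<close>
      have "(\<lambda>n. \<Sum>\<alpha>\<in>class_reps D 1. ball_freq (G n) \<alpha>) \<longlonglongrightarrow> (\<Sum>\<alpha>\<in>class_reps D 1. ?\<mu> 1 \<alpha>)"
        by (intro tendsto_sum \<mu>)
      moreover have "\<not> (\<forall>\<^sub>F n in sequentially. (\<Sum>\<alpha>\<in>class_reps D 1. ball_freq (G n) \<alpha>) \<noteq> 1)"
      proof
        assume "\<forall>\<^sub>F n in sequentially. (\<Sum>\<alpha>\<in>class_reps D 1. ball_freq (G n) \<alpha>) \<noteq> 1"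
        then have "\<forall>\<^sub>F n in sequentially. card (verts (G n)) = 1"
          by eventually_elim (use sum_ball_freq_radius_1[OF assms(2,5,3,4)] in blast)
        then show False using False by simp
      qed
      ultimately have "(\<Sum>\<alpha>\<in>class_reps D 1. ?\<mu> 1 \<alpha>) = 1"
        using tendsto_imp_eventually_ne by blast
      then show ?thesis by (rule AE_degree_bounded)
    qed (use single in simp)
    have "(\<integral>x. real (num_reduced (orbit_graph \<X> x) (Suc i) x) \<partial>M) = b i" for i
      unfolding integral_num_reduced_eq_measure_classes[OF deg] b_def
      by (intro sum.cong refl arg_cong2[where f = times] \<mu>_eq)
    then show ?thesis by (simp add: Z_def zeta_term_def zeta_graphing_def)
  qed
  ultimately show ?thesis by blast
qed

end
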